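(* Let $\kappa>0$ and let $\mathcal U\subset\mathbb R^2$ be an exterior region. Let $\mathcal D$ be an open bounded domain in $\mathbb R^2$ whose boundary $\Gamma=\partial\mathcal D$ is real analytic and connected, such that $\overline{\mathcal D}=\mathcal D\cup\Gamma\subset\mathcal U$, and such that $\kappa^2$ is not a Dirichlet eigenvalue of $-\Delta$ in $\mathcal D$. Let $\Lambda$ be an arbitrary non-empty open interval (arc) of $\Gamma$. Then every radiation solution $\psi$ of the Helmholtz equation $\Delta\psi+\kappa^2\psi=0$ in $\mathcal U$ is uniquely determined on $\mathcal U$ by $\mathrm{Im}(\psi)$ on $\Lambda$. That is, if $\psi_1,\psi_2$ are two radiation solutions in $\mathcal U$ (for the same $\kappa$) with $\mathrm{Im}(\psi_1)=\mathrm{Im}(\psi_2)$ on $\Lambda$, then $\psi_1=\psi_2$ on $\mathcal U$.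
   Context: An exterior region $\mathcal U$ is an open unbounded connected set in $\mathbb R^2$ consisting of all points outside a closed bounded regular curve $S$. A radiation solution in $\mathcal U$ (for fixed $\kappa>0$) is a complex-valued function $\psi$ of class $C^2$ on $\mathcal U$ satisfying $\Delta\psi(x)+\kappa^2\psi(x)=0$ for $x\in\mathcal U$ and the Sommerfeld radiation condition $\sqrt{|x|}\left(\frac{\partial}{\partial|x|}-i\kappa\right)\psi(x)\to0$ as $|x|\to+\infty$, uniformly in $x/|x|$. *)

theory Defs
  imports "HOL-Analysis.Analysis"
begin

definition partial_deriv :: "'n::finite \<Rightarrow> (real^'n \<Rightarrow> 'b::real_normed_vector) \<Rightarrow> real^'n \<Rightarrow> 'b" where
  "partial_deriv i f x = frechet_derivative f (at x) (axis i 1)"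

text \<open>Functions are total, so their values outside the open set \<open>U\<close> are irrelevant below.\<close>

definition C2_on :: "(real^'n) set \<Rightarrow> (real^'n \<Rightarrow> 'b::real_normed_vector) \<Rightarrow> bool" where
  "C2_on U f \<longleftrightarrow> f differentiable_on U
     \<and> (\<forall>i. partial_deriv i f differentiable_on U)
     \<and> (\<forall>i j. continuous_on U (partial_deriv j (partial_deriv i f)))"

definition laplacian :: "(real^'n \<Rightarrow> 'b::real_normed_vector) \<Rightarrow> real^'n \<Rightarrow> 'b" where
  "laplacian f x = (\<Sum>i\<in>UNIV. partial_deriv i (partial_deriv i f) x)"

text \<open>
  Regular means piecewise continuously differentiable with non-vanishing (at break points:
  one-sided) velocity. This is Kellogg's notion; curves that are regular without break points
  are the case \<open>T = {0, 1}\<close>.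
\<close>

definition piecewise_regular :: "(real \<Rightarrow> 'a::real_normed_vector) \<Rightarrow> bool" where
  "piecewise_regular \<gamma> \<longleftrightarrow> (\<exists>T. finite T \<and> {0, 1} \<subseteq> T \<and> T \<subseteq> {0..1} \<and>
     (\<forall>a\<in>T. \<forall>b\<in>T. a < b \<and> T \<inter> {a<..<b} = {} \<longrightarrow>
       (\<exists>\<gamma>'. continuous_on {a..b} \<gamma>' \<and>
         (\<forall>t\<in>{a..b}. (\<gamma> has_vector_derivative \<gamma>' t) (at t within {a..b}) \<and> \<gamma>' t \<noteq> 0))))"

definition closed_regular_curve :: "(real^2) set \<Rightarrow> bool" where
  "closed_regular_curve S \<longleftrightarrow> (\<exists>\<gamma>. simple_path \<gamma> \<and> pathfinish \<gamma> = pathstart \<gamma>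
     \<and> piecewise_regular \<gamma> \<and> path_image \<gamma> = S)"

definition exterior_region :: "(real^2) set \<Rightarrow> bool" where
  "exterior_region U \<longleftrightarrow> open U \<and> connected U \<and> \<not> bounded U
     \<and> (\<exists>S. closed_regular_curve S \<and> U = outside S)"

text \<open>
  On the ray through the unit vector \<open>\<omega>\<close>, the radial derivative at \<open>x = r *\<^sub>R \<omega>\<close> is the
  derivative in \<open>r\<close>.
\<close>

definition sommerfeld :: "real \<Rightarrow> (real^2 \<Rightarrow> complex) \<Rightarrow> bool" where
  "sommerfeld \<kappa> \<psi> \<longleftrightarrow>
     uniform_limit (sphere 0 1)
       (\<lambda>r \<omega>. of_real (sqrt r) *
          (vector_derivative (\<lambda>s. \<psi> (s *\<^sub>R \<omega>)) (at r) - \<i> * of_real \<kappa> * \<psi> (r *\<^sub>R \<omega>)))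
       (\<lambda>_. 0) at_top"

definition radiation_solution :: "real \<Rightarrow> (real^2) set \<Rightarrow> (real^2 \<Rightarrow> complex) \<Rightarrow> bool" where
  "radiation_solution \<kappa> U \<psi> \<longleftrightarrow> C2_on U \<psi>
     \<and> (\<forall>x\<in>U. laplacian \<psi> x + of_real (\<kappa>\<^sup>2) * \<psi> x = 0)
     \<and> sommerfeld \<kappa> \<psi>"

definition real_analytic_at :: "(real \<Rightarrow> 'a::real_normed_vector) \<Rightarrow> real \<Rightarrow> bool" where
  "real_analytic_at \<gamma> s \<longleftrightarrow>
     (\<exists>a. \<exists>r>0. \<forall>t. \<bar>t - s\<bar> < r \<longrightarrow> (\<lambda>n. (t - s) ^ n *\<^sub>R a n) sums \<gamma> t)"

text \<open>One-dimensional embedded real analytic submanifolds of the plane, by local regular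
  parametrisations.\<close>

definition real_analytic_curve :: "(real^2) set \<Rightarrow> bool" where
  "real_analytic_curve \<Gamma> \<longleftrightarrow> (\<forall>p\<in>\<Gamma>. \<exists>V \<gamma> g. open V \<and> p \<in> V
     \<and> homeomorphism {-1<..<1} (\<Gamma> \<inter> V) \<gamma> g
     \<and> (\<forall>t\<in>{-1<..<1}. real_analytic_at \<gamma> t \<and> vector_derivative \<gamma> (at t) \<noteq> 0))"

definition open_arc_of :: "(real^2) set \<Rightarrow> (real^2) set \<Rightarrow> bool" where
  "open_arc_of \<Gamma> \<Lambda> \<longleftrightarrow> openin (top_of_set \<Gamma>) \<Lambda> \<and> \<Lambda> homeomorphic {0<..<1::real}"

definition dirichlet_eigenvalue :: "(real^2) set \<Rightarrow> real \<Rightarrow> bool" where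
  "dirichlet_eigenvalue D \<mu> \<longleftrightarrow> (\<exists>u :: real^2 \<Rightarrow> complex. C2_on D u
     \<and> continuous_on (closure D) u
     \<and> (\<forall>x\<in>D. - laplacian u x = of_real \<mu> * u x)
     \<and> (\<forall>x\<in>frontier D. u x = 0)
     \<and> (\<exists>x\<in>D. u x \<noteq> 0))"

end

theory Submission
  imports Defs "HOL-Complex_Analysis.Complex_Analysis" "HOL-Real_Asymp.Real_Asymp"
begin

text \<open>
  Let \<open>\<psi> = \<psi>\<^sub>1 - \<psi>\<^sub>2\<close>. On circles around a point the Fourier coefficients of a solution of the
  Helmholtz equation satisfy Bessel's equation. Around an interior point the coefficients are therefore
  multiples of Bessel functions, which gives a series expansion that continues to complex arguments;
  so \<open>Im \<psi>\<close> is real analytic along \<open>\<Gamma>\<close> and vanishes on all of it. Since \<open>\<kappa>\<^sup>2\<close> is not a Dirichlet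
  eigenvalue, \<open>Im \<psi> = 0\<close> in \<open>D\<close>, and by unique continuation in \<open>U\<close>. For a real-valued \<open>\<psi>\<close> the real and
  imaginary parts of the radiation condition say that \<open>sqrt r\<close> times \<open>\<partial>\<psi>/\<partial>r\<close> and \<open>sqrt r\<close> times \<open>\<psi>\<close>
  both tend to \<open>0\<close>. The Fourier coefficients on large circles are then solutions of Bessel's equation that
  decay too fast, so they vanish (Rellich), and unique continuation gives \<open>\<psi> = 0\<close>.
\<close>

text \<open>The imaginary part solves the Helmholtz equation, because Im is real linear and
  \<open>\<kappa>\<close> is real, but it need not satisfy any radiation condition. Nothing at
  infinity is therefore available for it: its zeros must first be carried from the arc to an open
  set, and this is where the curve and the eigenvalue condition enter. The radiation condition comes
  in only once the difference of the two solutions is known to be real.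

  Solutions are only assumed to be C^2. Both their analyticity and their behaviour at infinity are
  drawn from one device: the Fourier coefficients on circles solve a real second-order ODE in the
  radius, and solutions that are regular at 0, or that decay faster than r^(-1/2) at infinity
  together with their derivative, can be classified by hand. No fundamental solution and no integral
  representation is involved.

  Every continuation is reduced to one real variable: composed with a real analytic parametrisation,
  a solution extends to a holomorphic function of the parameter. Charts of the boundary curve and
  straight lines in the plane are treated alike in this way.\<close>

section \<open>Bessel's equation\<close>

text \<open>
  For \<open>w = sqrt r * y\<close> the energy \<open>w'\<^sup>2 + (\<kappa> * w)\<^sup>2\<close> times \<open>exp (- C / r)\<close> is nondecreasing and tends
  to \<open>0\<close>, hence vanishes.
\<close>

lemma bessel_decay_zero:
  fixes y y' :: "real \<Rightarrow> real" and \<mu> \<kappa> R :: real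
  assumes \<kappa>: "\<kappa> > 0" and R: "R \<ge> 0"
    and y: "\<And>r. r > R \<Longrightarrow> (y has_real_derivative y' r) (at r)"
    and y': "\<And>r. r > R \<Longrightarrow> (y' has_real_derivative (- y' r / r - (\<kappa>\<^sup>2 - \<mu> / r\<^sup>2) * y r)) (at r)"
    and lim: "((\<lambda>r. sqrt r * y r) \<longlongrightarrow> 0) at_top"
    and lim': "((\<lambda>r. sqrt r * y' r) \<longlongrightarrow> 0) at_top"
    and r: "r > R"
  shows "y r = 0"
proof -
  \<comment> \<open>This substitution removes the first-order term: w'' = ((mu - 1/4) / r^2 -
    kappa^2) * w, an oscillator of frequency kappa with an integrable perturbation.\<close>
  define w where "w = (\<lambda>r. sqrt r * y r)"
  define w' where "w' = (\<lambda>r. sqrt r * y' r + y r / (2 * sqrt r))"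
  define E where "E = (\<lambda>r. (w' r)\<^sup>2 + (\<kappa> * w r)\<^sup>2)"
  \<comment> \<open>Since 2 * |kappa * w * w'| is at most \<open>E\<close>, the derivative of
    \<open>E\<close> is at most \<open>C * E r / r\<^sup>2\<close> in absolute value. As C / r^2 is
    the derivative of - C / r, this fixes both the constant and the exponential factor in
    \<open>F\<close>.\<close>
  define C where "C = \<bar>\<mu> - 1/4\<bar> / \<kappa>"
  define F where "F = (\<lambda>r. E r * exp (- C / r))"
  have E0: "E r \<ge> 0" for r by (simp add: E_def)
  have w: "(w has_real_derivative w' r) (at r)" if "r > R" for r
    using that R unfolding w_def w'_def
    by (auto intro!: derivative_eq_intros y simp: field_simps)
  have w': "(w' has_real_derivative ((\<mu> - 1/4) / r\<^sup>2 - \<kappa>\<^sup>2) * w r) (at r)" if "r > R" for r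
  proof -
    define s where "s = sqrt r"
    have s: "s > 0" "r = s^2" "sqrt (s^2) = s" using that R by (auto simp: s_def)
    have "(w' has_real_derivative (inverse s / 2 * y' r + s * (- y' r / r - (\<kappa>\<^sup>2 - \<mu> / r\<^sup>2) * y r)
         + (y' r * (2 * s) - y r * (inverse s)) / (2 * s)^2)) (at r)"
      unfolding w'_def using that R s(1)
      by (auto intro!: derivative_eq_intros y y' simp: s_def power2_eq_square)
    also have "inverse s / 2 * y' r + s * (- y' r / r - (\<kappa>\<^sup>2 - \<mu> / r\<^sup>2) * y r)
         + (y' r * (2 * s) - y r * (inverse s)) / (2 * s)^2 = ((\<mu> - 1/4) / r\<^sup>2 - \<kappa>\<^sup>2) * w r"
      unfolding w_def s_def[symmetric] using s(1) unfolding s(2)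
      by (simp add: field_simps power2_eq_square s(3)[unfolded power2_eq_square])
    finally show ?thesis .
  qed
  have E: "(E has_real_derivative 2 * ((\<mu> - 1/4) / r\<^sup>2) * w r * w' r) (at r)" if "r > R" for r
    unfolding E_def using that
    by (auto intro!: derivative_eq_intros w w') (simp add: algebra_simps power2_eq_square)
  have F: "(F has_real_derivative (2 * ((\<mu> - 1/4) / r\<^sup>2) * w r * w' r + E r * (C / r\<^sup>2)) * exp (- C / r)) (at r)"
    if "r > R" for r
  proof -
    have "((\<lambda>r. exp (- C / r)) has_real_derivative exp (- C / r) * (C / r\<^sup>2)) (at r)"
      using that R by (auto intro!: derivative_eq_intros simp: power2_eq_square)
    from DERIV_mult[OF E[OF that] this] show ?thesis
      unfolding F_def by (simp add: algebra_simps)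
  qed
  have nonneg: "(2 * ((\<mu> - 1/4) / r\<^sup>2) * w r * w' r + E r * (C / r\<^sup>2)) * exp (- C / r) \<ge> 0" if "r > R" for r
  proof -
    have "2 * \<bar>\<kappa> * w r\<bar> * \<bar>w' r\<bar> \<le> E r"
      using sum_squares_bound[of "\<bar>\<kappa> * w r\<bar>" "\<bar>w' r\<bar>"] unfolding E_def by simp
    then have "C * (2 * \<bar>\<kappa> * w r\<bar> * \<bar>w' r\<bar>) \<le> C * E r"
      by (rule mult_left_mono) (use \<kappa> in \<open>simp add: C_def\<close>)
    moreover have "C * (2 * \<bar>\<kappa> * w r\<bar> * \<bar>w' r\<bar>) = \<bar>2 * (\<mu> - 1/4) * w r * w' r\<bar>"
      unfolding C_def abs_mult using \<kappa> by simp
    ultimately have "0 \<le> 2 * (\<mu> - 1/4) * w r * w' r + C * E r" by linarith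
    then have "0 \<le> (2 * (\<mu> - 1/4) * w r * w' r + C * E r) / r^2" by simp
    also have "\<dots> = 2 * ((\<mu> - 1/4) / r\<^sup>2) * w r * w' r + E r * (C / r\<^sup>2)"
      by (simp add: add_divide_distrib mult.commute)
    finally show ?thesis by simp
  qed
  have mono: "F r \<le> F t" if "r \<le> t" for t
  proof (rule DERIV_nonneg_imp_nondecreasing[OF that])
    fix x assume "r \<le> x"
    then have "x > R" using r by simp
    from F[OF this] nonneg[OF this]
    show "\<exists>y. (F has_real_derivative y) (at x) \<and> 0 \<le> y" by blast
  qed
  have wl: "(w \<longlongrightarrow> 0) at_top" using lim by (simp add: w_def)
  have inv: "((\<lambda>r::real. 1 / (2 * r)) \<longlongrightarrow> 0) at_top" by real_asymp
  have "((\<lambda>r. sqrt r * y' r + w r * (1 / (2 * r))) \<longlongrightarrow> 0 + 0 * 0) at_top"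
    by (intro tendsto_intros lim' wl inv)
  moreover have "\<forall>\<^sub>F r in at_top. sqrt r * y' r + w r * (1 / (2 * r)) = w' r"
    using eventually_gt_at_top[of 0]
  proof eventually_elim
    case (elim r)
    have "sqrt r * (1 / (2*r)) = 1 / (2 * sqrt r)"
      using elim by (simp add: field_simps)
    then have "w r * (1 / (2 * r)) = y r * (1 / (2 * sqrt r))"
      unfolding w_def by (metis mult.assoc mult.commute)
    then show ?case by (simp add: w'_def)
  qed
  ultimately have "(w' \<longlongrightarrow> 0) at_top"
    using tendsto_cong by force
  then have "(E \<longlongrightarrow> 0^2 + (\<kappa> * 0)^2) at_top"
    unfolding E_def by (intro tendsto_intros wl)
  moreover have "((\<lambda>r. exp (- C / r)) \<longlongrightarrow> exp 0) at_top"
    by real_asymp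
  ultimately have "(F \<longlongrightarrow> (0^2 + (\<kappa> * 0)^2) * exp 0) at_top"
    unfolding F_def by (rule tendsto_mult)
  then have "(F \<longlongrightarrow> 0) at_top" by simp
  moreover have "\<forall>\<^sub>F t in at_top. F r \<le> F t"
    using eventually_ge_at_top[of r] by eventually_elim (rule mono)
  ultimately have "F r \<le> 0" by (rule tendsto_lowerbound) simp
  then have "E r \<le> 0" unfolding F_def by (simp add: mult_le_0_iff)
  then have "E r = 0" using E0[of r] by linarith
  then have "(w' r)\<^sup>2 + (\<kappa> * w r)\<^sup>2 = 0" by (simp only: E_def)
  then have "\<kappa> * w r = 0" by (simp add: sum_power2_eq_zero_iff)
  then show ?thesis using \<kappa> r R by (simp add: w_def)
qed

section \<open>Power series of the Bessel functions and solutions regular at the origin\<close>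

text \<open>The Bessel function \<open>J\<^sub>n\<close> is, up to a constant factor, \<open>r ^ n * bessel_part n (r\<^sup>2)\<close>.\<close>

definition bessel_coeff :: "nat \<Rightarrow> nat \<Rightarrow> 'a::{real_normed_field,banach}" where
  "bessel_coeff n k = of_real ((- 1 / 4) ^ k * fact n / (fact k * fact (n + k)))"

definition bessel_part :: "nat \<Rightarrow> 'a::{real_normed_field,banach} \<Rightarrow> 'a" where
  "bessel_part n t = (\<Sum>k. bessel_coeff n k * t ^ k)"

lemma norm_bessel_coeff_le: "norm (bessel_coeff n k :: 'a::{real_normed_field,banach}) \<le> (1 / 4) ^ k / fact k"
proof -
  have "fact n \<le> (fact (n + k) :: real)" by (rule fact_mono) simp
  then have "fact n / (fact (n + k)) \<le> (1::real)" by simp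
  then have "(1/4)^k / fact k * (fact n / fact (n + k)) \<le> (1/4::real)^k / fact k * 1"
    by (intro mult_left_mono) auto
  then show ?thesis unfolding bessel_coeff_def norm_of_real
    by (simp add: abs_mult power_abs)
qed

lemma summable_bessel: "summable (\<lambda>k. bessel_coeff n k * t ^ k :: 'a::{real_normed_field,banach})"
proof (rule summable_comparison_test[OF _ summable_exp[of "norm t / 4"]])
  show "\<exists>N. \<forall>k\<ge>N. norm (bessel_coeff n k * t ^ k) \<le> inverse (fact k) * (norm t / 4) ^ k"
  proof (intro exI allI impI)
    fix k
    have "norm (bessel_coeff n k * t ^ k) \<le> (1 / 4) ^ k / fact k * norm t ^ k"
      unfolding norm_mult norm_power by (intro mult_right_mono norm_bessel_coeff_le) simp
    also have "\<dots> = inverse (fact k) * (norm t / 4) ^ k"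
      by (simp add: power_divide field_simps)
    finally show "norm (bessel_coeff n k * t ^ k) \<le> inverse (fact k) * (norm t / 4) ^ k" .
  qed
qed

lemma bessel_part_sums: "(\<lambda>k. bessel_coeff n k * t ^ k) sums bessel_part n t"
  unfolding bessel_part_def using summable_bessel by (rule summable_sums)

text \<open>The real series solves the ODE in the radius, the complex one occurs in the local
  expansion. The definition is polymorphic so that the two can be matched here.\<close>

lemma of_real_bessel_part: "of_real (bessel_part n t) = bessel_part n (of_real t :: 'a::{real_normed_field,banach})"
proof -
  have "(\<lambda>k. of_real (bessel_coeff n k * t ^ k) :: 'a) sums of_real (bessel_part n t)"
    using bessel_part_sums by (rule sums_of_real)
  then have "(\<lambda>k. bessel_coeff n k * of_real t ^ k :: 'a) sums of_real (bessel_part n t)"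
    by (simp only: bessel_coeff_def of_real_eq_id id_apply of_real_mult of_real_power)
  then show ?thesis using bessel_part_sums sums_unique2 by blast
qed

text \<open>The factor \<open>fact n\<close> normalises the constant term to 1, and the other terms
  are dominated by 1/4 + 1/16 + ... = 1/3. Hence the norm lies between 2/3 and 4/3 for all n at
  once: the lower bound allows division by the Bessel factor, the upper bound yields a majorant for
  the expansion.\<close>

lemma norm_bessel_part_diff_one:
  fixes t :: "'a::{real_normed_field,banach}"
  assumes "norm t \<le> 1"
  shows "norm (bessel_part n t - 1) \<le> 1 / 3"
proof -
  have *: "(\<lambda>k. bessel_coeff n (Suc k) * t ^ Suc k) sums (bessel_part n t - 1)"
    using bessel_part_sums[of n t] by (subst sums_Suc_iff) (simp add: bessel_coeff_def)
  have le: "norm (bessel_coeff n (Suc k) * t ^ Suc k) \<le> (1/4) * (1 / 4) ^ k" for k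
  proof -
    have "norm (bessel_coeff n (Suc k) * t ^ Suc k) \<le> (1 / 4) ^ Suc k * 1"
      unfolding norm_mult norm_power
    proof (intro mult_mono)
      have "(1 / 4 :: real) ^ Suc k / fact (Suc k) \<le> (1/4) ^ Suc k / 1"
        by (intro divide_left_mono) (auto simp del: fact_Suc)
      then show "norm (bessel_coeff n (Suc k) :: 'a) \<le> (1 / 4) ^ Suc k"
        using norm_bessel_coeff_le[of n "Suc k", where 'a = 'a] by linarith
      show "norm t ^ Suc k \<le> 1" using assms power_le_one[of "norm t" "Suc k"] by simp
    qed auto
    then show ?thesis by simp
  qed
  have g: "(\<lambda>k. (1/4) * (1 / 4 :: real) ^ k) sums ((1/4) * (1 / (1 - 1/4)))"
    by (intro sums_mult geometric_sums) simp
  have "norm (\<Sum>k. bessel_coeff n (Suc k) * t ^ Suc k) \<le> (\<Sum>k. (1/4) * (1 / 4 :: real) ^ k)"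
    using le g by (intro norm_suminf_le) (auto simp: sums_iff)
  then show ?thesis using * g by (simp add: sums_iff)
qed

text \<open>Bessel's equation for \<open>r ^ n * bessel_part n (r\<^sup>2)\<close>, rewritten in the
  variable t = r^2.\<close>

lemma bessel_part_ode:
  obtains \<phi> \<phi>' :: "'a::{real_normed_field,banach} \<Rightarrow> 'a" where
    "\<And>t. (bessel_part n has_field_derivative \<phi> t) (at t)"
    "\<And>t. (\<phi> has_field_derivative \<phi>' t) (at t)"
    "\<And>t. t * \<phi>' t + of_nat (n + 1) * \<phi> t = - bessel_part n t / 4"
proof
  define c where "c = (bessel_coeff n :: nat \<Rightarrow> 'a)"
  define \<phi> where "\<phi> = (\<lambda>t. \<Sum>k. diffs c k * t ^ k)"
  define \<phi>' where "\<phi>' = (\<lambda>t. \<Sum>k. diffs (diffs c) k * t ^ k)"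
  have s: "summable (\<lambda>k. c k * t ^ k)" for t unfolding c_def by (rule summable_bessel)
  have s1: "summable (\<lambda>k. diffs c k * t ^ k)" for t
    by (rule termdiff_converges_all) (rule s)
  have s2: "summable (\<lambda>k. diffs (diffs c) k * t ^ k)" for t
    by (rule termdiff_converges_all) (rule s1)
  show "(bessel_part n has_field_derivative \<phi> t) (at t)" for t
    unfolding bessel_part_def[abs_def] c_def[symmetric] \<phi>_def
    by (rule termdiffs_strong_converges_everywhere) (rule s)
  show "(\<phi> has_field_derivative \<phi>' t) (at t)" for t
    unfolding \<phi>_def[abs_def] \<phi>'_def
    by (rule termdiffs_strong_converges_everywhere) (rule s1)
  show "t * \<phi>' t + of_nat (n + 1) * \<phi> t = - bessel_part n t / 4" for t
  proof -
    have "(\<lambda>k. t * (diffs (diffs c) k * t ^ k)) sums (t * \<phi>' t)"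
      unfolding \<phi>'_def by (intro sums_mult summable_sums s2)
    then have "(\<lambda>k. of_nat (Suc k) * diffs c (Suc k) * t ^ Suc k) sums (t * \<phi>' t)"
      by (simp add: diffs_def mult_ac)
    then have "(\<lambda>k. of_nat k * diffs c k * t ^ k) sums (t * \<phi>' t)"
      by (subst (asm) sums_Suc_iff) simp
    moreover have "(\<lambda>k. of_nat (n + 1) * (diffs c k * t ^ k)) sums (of_nat (n + 1) * \<phi> t)"
      unfolding \<phi>_def by (intro sums_mult summable_sums s1)
    ultimately have "(\<lambda>k. of_nat k * diffs c k * t ^ k + of_nat (n + 1) * (diffs c k * t ^ k))
        sums (t * \<phi>' t + of_nat (n + 1) * \<phi> t)" by (rule sums_add)
    moreover have "of_nat k * diffs c k * t ^ k + of_nat (n + 1) * (diffs c k * t ^ k)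
        = - (c k * t ^ k / 4)" for k
    proof -
      define b where "b = (bessel_coeff n :: nat \<Rightarrow> real)"
      have c: "c = (\<lambda>k. of_real (b k))"
        by (simp only: c_def b_def bessel_coeff_def[abs_def] of_real_eq_id id_apply)
      \<comment> \<open>The recurrence of the coefficients, checked over the reals and then embedded
        into \<open>'a\<close>.\<close>
      have "(real k + real (n + 1)) * (real (Suc k) * b (Suc k)) = - (b k / 4)"
        unfolding b_def bessel_coeff_def of_real_eq_id id_apply
        by (simp add: divide_simps del: of_nat_Suc)
      then have "of_real ((real k + real (n + 1)) * (real (Suc k) * b (Suc k))) = (of_real (- (b k / 4)) :: 'a)"
        by (rule arg_cong)
      then have "(of_nat k + of_nat (n + 1)) * (of_nat (Suc k) * c (Suc k)) = - (c k / 4)"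
        unfolding c by (simp del: of_nat_Suc of_nat_add)
      then have "(of_nat k + of_nat (n + 1)) * diffs c k = - (c k / 4)"
        by (simp add: diffs_def)
      from arg_cong[OF this, of "\<lambda>x. x * t ^ k"] show ?thesis
        by (simp add: algebra_simps)
    qed
    ultimately have "(\<lambda>k. - (c k * t ^ k / 4)) sums (t * \<phi>' t + of_nat (n + 1) * \<phi> t)"
      by simp
    moreover have "(\<lambda>k. - (c k * t ^ k / 4)) sums (- (bessel_part n t / 4))"
      unfolding c_def by (intro sums_minus sums_divide bessel_part_sums)
    ultimately have "t * \<phi>' t + of_nat (n + 1) * \<phi> t = - (bessel_part n t / 4)"
      by (rule sums_unique2)
    then show ?thesis by simp
  qed
qed

text \<open>The Wronskian with the regular Bessel solution \<open>j\<close>, multiplied by r, is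
  constant and vanishes at 0, so \<open>y / j\<close> is constant. Continuity of \<open>y'\<close>
  at 0 is what rules out the second solution, which is unbounded there;
  \<open>\<kappa> * R \<le> 1\<close> keeps \<open>j\<close> positive on the open interval from 0 to
  \<open>R\<close>.\<close>

lemma bessel_regular_solution:
  fixes y y' :: "real \<Rightarrow> real" and \<kappa> R :: real
  assumes \<kappa>: "\<kappa> > 0" and R: "R > 0" "\<kappa> * R \<le> 1"
    and y: "\<And>r. \<bar>r\<bar> < R \<Longrightarrow> (y has_real_derivative y' r) (at r)"
    and y': "\<And>r. \<bar>r\<bar> < R \<Longrightarrow> r \<noteq> 0 \<Longrightarrow> (y' has_real_derivative (- y' r / r - (\<kappa>\<^sup>2 - (real n)\<^sup>2 / r\<^sup>2) * y r)) (at r)"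
    and y'0: "isCont y' 0"
  shows "\<exists>c. \<forall>r. 0 \<le> r \<and> r < R \<longrightarrow> y r = c * (r ^ n * bessel_part n ((\<kappa> * r)\<^sup>2))"
proof -
  obtain \<phi> \<phi>' :: "real \<Rightarrow> real" where
    d1: "\<And>t. (bessel_part n has_field_derivative \<phi> t) (at t)" and
    d2: "\<And>t. (\<phi> has_field_derivative \<phi>' t) (at t)" and
    ode: "\<And>t. t * \<phi>' t + real (n + 1) * \<phi> t = - bessel_part n t / 4"
    using bessel_part_ode[of n] by (metis (no_types))
  define B where "B = (bessel_part n :: real \<Rightarrow> real)"
  define j where "j = (\<lambda>r. r ^ n * B ((\<kappa> * r)\<^sup>2))"
  \<comment> \<open>This is r times the derivative of \<open>j\<close>, written without division so
    that it is continuous at 0.\<close>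
  define h where "h = (\<lambda>r. r ^ n * (real n * B ((\<kappa> * r)\<^sup>2) + 2 * (\<kappa> * r)\<^sup>2 * \<phi> ((\<kappa> * r)\<^sup>2)))"
  \<comment> \<open>r times the Wronskian of \<open>y\<close> and \<open>j\<close>; both Bessel
    equations together make its derivative 0.\<close>
  define W where "W = (\<lambda>r. y r * h r - r * y' r * j r)"
  note dB[derivative_intros] = DERIV_chain2[OF d1[folded B_def]]
  note d\<phi>[derivative_intros] = DERIV_chain2[OF d2]
  have dpow: "((\<lambda>r. r ^ n) has_real_derivative real n * r ^ n / r) (at r)" if "r \<noteq> 0" for r :: real
    using DERIV_pow[of n r] that by (cases n) auto
  have j: "(j has_real_derivative h r / r) (at r)" if "r \<noteq> 0" for r
  proof -
    have "((\<lambda>r. B ((\<kappa> * r)\<^sup>2)) has_real_derivative \<phi> ((\<kappa> * r)\<^sup>2) * (2 * \<kappa>\<^sup>2 * r)) (at r)"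
      by (auto intro!: derivative_eq_intros simp: power2_eq_square)
    from DERIV_mult[OF dpow[OF that] this] show ?thesis
      unfolding j_def h_def using that by (simp add: field_simps power2_eq_square)
  qed
  have h: "(h has_real_derivative (- (\<kappa>\<^sup>2 * r - (real n)\<^sup>2 / r) * j r)) (at r)" if "r \<noteq> 0" for r
  proof -
    define q where "q = (\<kappa> * r)\<^sup>2"
    have "(h has_real_derivative (real n * r ^ n / r) * (real n * B q + 2 * q * \<phi> q)
       + r ^ n * (real n * \<phi> q * (2 * \<kappa>\<^sup>2 * r) + 2 * (2 * \<kappa>\<^sup>2 * r) * \<phi> q + 2 * q * \<phi>' q * (2 * \<kappa>\<^sup>2 * r))) (at r)"
    proof -
      have "((\<lambda>r. real n * B ((\<kappa> * r)\<^sup>2) + 2 * (\<kappa> * r)\<^sup>2 * \<phi> ((\<kappa> * r)\<^sup>2)) has_real_derivative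
         (real n * \<phi> q * (2 * \<kappa>\<^sup>2 * r) + 2 * (2 * \<kappa>\<^sup>2 * r) * \<phi> q + 2 * q * \<phi>' q * (2 * \<kappa>\<^sup>2 * r))) (at r)"
        unfolding q_def by (auto intro!: derivative_eq_intros simp: power2_eq_square algebra_simps)
      from DERIV_mult[OF dpow[OF that] this] show ?thesis
        unfolding h_def q_def by (simp add: algebra_simps)
    qed
    also have "(real n * r ^ n / r) * (real n * B q + 2 * q * \<phi> q)
       + r ^ n * (real n * \<phi> q * (2 * \<kappa>\<^sup>2 * r) + 2 * (2 * \<kappa>\<^sup>2 * r) * \<phi> q + 2 * q * \<phi>' q * (2 * \<kappa>\<^sup>2 * r))
       = r ^ n / r * ((real n)\<^sup>2 * B q + 4 * q * (q * \<phi>' q + real (n + 1) * \<phi> q))"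
      using that unfolding q_def by (simp add: field_simps power2_eq_square)
    also have "q * \<phi>' q + real (n + 1) * \<phi> q = - B q / 4"
      using ode[of q] by (simp add: B_def)
    also have "r ^ n / r * ((real n)\<^sup>2 * B q + 4 * q * (- B q / 4)) = - (\<kappa>\<^sup>2 * r - (real n)\<^sup>2 / r) * j r"
      using that unfolding j_def q_def by (simp add: field_simps power2_eq_square)
    finally show ?thesis .
  qed
  have cB: "continuous_on A B" for A
    using d1 unfolding B_def by (intro DERIV_continuous_on) (auto intro: has_field_derivative_at_within)
  have c\<phi>: "continuous_on A \<phi>" for A
    using d2 by (intro DERIV_continuous_on) (auto intro: has_field_derivative_at_within)
  have cj: "continuous_on A j" for A
    unfolding j_def by (intro continuous_intros continuous_on_compose2[OF cB]) auto
  have ch: "continuous_on A h" for A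
    unfolding h_def by (intro continuous_intros continuous_on_compose2[OF cB] continuous_on_compose2[OF c\<phi>]) auto
  have cy: "continuous_on {0..r} y" if "r < R" for r
    using that by (intro continuous_at_imp_continuous_on ballI DERIV_isCont[OF y]) auto
  have "isCont y' s" if "\<bar>s\<bar> < R" for s
    using y'0 DERIV_isCont[OF y'[OF that]] by (cases "s = 0") auto
  then have cy': "continuous_on {0..r} y'" if "r < R" for r
    using that by (intro continuous_at_imp_continuous_on ballI) auto
  have W: "(W has_real_derivative 0) (at r)" if "0 < r" "r < R" for r
  proof -
    have "(W has_real_derivative y' r * h r + (- (\<kappa>\<^sup>2 * r - (real n)\<^sup>2 / r) * j r) * y r
        - ((1 * y' r + (- y' r / r - (\<kappa>\<^sup>2 - (real n)\<^sup>2 / r\<^sup>2) * y r) * r) * j r + (h r / r) * (r * y' r))) (at r)"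
      unfolding W_def using that
      by (intro DERIV_diff DERIV_mult DERIV_ident j h y y') auto
    moreover have "y' r * h r + (- (\<kappa>\<^sup>2 * r - (real n)\<^sup>2 / r) * j r) * y r
        - ((1 * y' r + (- y' r / r - (\<kappa>\<^sup>2 - (real n)\<^sup>2 / r\<^sup>2) * y r) * r) * j r + (h r / r) * (r * y' r)) = 0"
      using that by (simp add: field_simps power2_eq_square)
    ultimately show ?thesis by simp
  qed
  have W0: "W r = 0" if "0 < r" "r < R" for r
  proof -
    have "continuous_on {0..r} W"
      unfolding W_def using that by (intro continuous_intros cy cy' cj ch)
    then have "W r = W 0"
      using W that by (intro DERIV_isconst_end) auto
    \<comment> \<open>For n > 0 the power of r vanishes at 0; for n = 0 the bracket in
      \<open>h\<close> does.\<close>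
    also have "W 0 = 0" by (cases n) (auto simp: W_def h_def)
    finally show ?thesis .
  qed
  have Bpos: "B ((\<kappa> * r)\<^sup>2) > 0" if "0 \<le> r" "r < R" for r
  proof -
    have "\<kappa> * r \<le> \<kappa> * R" using that \<kappa> by simp
    then have "\<kappa> * r \<le> 1" using R by linarith
    then have "(\<kappa> * r)\<^sup>2 \<le> 1" using that \<kappa> by (simp add: power_le_one)
    then have "\<bar>B ((\<kappa> * r)\<^sup>2) - 1\<bar> \<le> 1 / 3"
      using norm_bessel_part_diff_one[of "(\<kappa> * r)\<^sup>2" n] by (simp add: B_def)
    then show ?thesis by linarith
  qed
  have jpos: "j r > 0" if "0 < r" "r < R" for r
    using Bpos[of r] that by (simp add: j_def)
  define c where "c = y (R / 2) / j (R / 2)"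
  have q: "((\<lambda>r. y r / j r) has_real_derivative 0) (at r)" if "0 < r" "r < R" for r
  proof -
    have "((\<lambda>r. y r / j r) has_real_derivative ((y' r * j r - y r * (h r / r)) / (j r * j r))) (at r)"
      using that jpos[of r] by (intro DERIV_divide y j) auto
    also have "y' r * j r - y r * (h r / r) = - W r / r"
      using that by (simp add: W_def field_simps)
    finally show ?thesis using W0[OF that] by simp
  qed
  have yc: "y r = c * j r" if "0 < r" "r < R" for r
  proof -
    have "y r / j r = c"
      unfolding c_def
    proof (rule DERIV_zero_connected_constant[of "{0<..<R}" "{}"])
      show "continuous_on {0<..<R} (\<lambda>r. y r / j r)"
        by (intro continuous_at_imp_continuous_on ballI DERIV_isCont[OF q]) auto
    qed (use q that in auto)
    then show ?thesis using jpos[OF that] by (simp add: field_simps)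
  qed
  have "y 0 = c * j 0"
  proof -
    define r where "r = R / 2"
    have r: "0 < r" "r < R" using R by (auto simp: r_def)
    have "y x - c * j x = 0" if "x \<in> {0..r}" for x
    proof (rule continuous_constant_on_closure[of "{0<..<r}" "\<lambda>r. y r - c * j r" 0 x])
      show "continuous_on (closure {0<..<r}) (\<lambda>r. y r - c * j r)"
        using r by (auto intro!: continuous_intros cy cj)
    qed (use that yc r in auto)
    from this[of 0] show ?thesis using r by simp
  qed
  with yc have "\<forall>r. 0 \<le> r \<and> r < R \<longrightarrow> y r = c * j r"
    by (metis order_le_less)
  then show ?thesis unfolding j_def B_def by blast
qed

section \<open>Fourier coefficients on the circle\<close>

definition fourier_coeff :: "int \<Rightarrow> (real \<Rightarrow> complex) \<Rightarrow> complex" where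
  "fourier_coeff n h = integral {0..2 * pi} (\<lambda>\<theta>. h \<theta> * cis (- of_int n * \<theta>))"

lemma continuous_on_cis_mult: "continuous_on A (\<lambda>\<theta>. cis (c * \<theta>))"
  by (intro continuous_intros)

lemma fourier_coeff_integrable:
  assumes "continuous_on {0..2 * pi} h"
  shows "(\<lambda>\<theta>. h \<theta> * cis (- of_int n * \<theta>)) integrable_on {0..2 * pi}"
  by (intro integrable_continuous_real continuous_intros assms)

lemma fourier_coeff_diff:
  assumes "continuous_on {0..2 * pi} h" "continuous_on {0..2 * pi} k"
  shows "fourier_coeff n (\<lambda>\<theta>. h \<theta> - k \<theta>) = fourier_coeff n h - fourier_coeff n k"
  unfolding fourier_coeff_def left_diff_distrib
  by (intro integral_diff fourier_coeff_integrable assms)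

lemma norm_fourier_coeff_le:
  assumes "continuous_on {0..2 * pi} h" "\<And>\<theta>. norm (h \<theta>) \<le> M"
  shows "norm (fourier_coeff n h) \<le> 2 * pi * M"
proof -
  have "norm (fourier_coeff n h) \<le> M * (2 * pi - 0)"
    unfolding fourier_coeff_def
    by (rule integral_bound) (auto intro!: continuous_intros assms simp: norm_mult)
  then show ?thesis by (simp add: mult_ac)
qed

lemma fourier_coeff_cis:
  "fourier_coeff n (\<lambda>\<theta>. cis (of_int m * \<theta>)) = (if n = m then of_real (2 * pi) else 0)"
proof (cases "n = m")
  case True
  have "fourier_coeff n (\<lambda>\<theta>. cis (of_int m * \<theta>)) = integral {0..2 * pi} (\<lambda>\<theta>. 1)"
    unfolding fourier_coeff_def True by (simp add: cis_mult flip: distrib_right)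
  then show ?thesis using True by (simp add: scaleR_conv_of_real)
next
  case False
  define d where "d = (of_int (m - n) :: real)"
  have d: "d \<noteq> 0" using False by (simp add: d_def)
  have "((\<lambda>\<theta>. cis (d * \<theta>)) has_integral (cis (d * (2 * pi)) / (\<i> * d) - cis (d * 0) / (\<i> * d))) {0..2 * pi}"
  proof (intro fundamental_theorem_of_calculus)
    fix x
    define c where "c = \<i> * complex_of_real d"
    have "c \<noteq> 0" using d by (simp add: c_def)
    then have "((\<lambda>z. exp (c * z) / c) has_field_derivative exp (c * of_real x)) (at (of_real x))"
      by (auto intro!: derivative_eq_intros)
    from has_vector_derivative_real_field[OF this]
    show "((\<lambda>\<theta>. cis (d * \<theta>) / (\<i> * of_real d)) has_vector_derivative cis (d * x)) (at x within {0..2 * pi})"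
      by (simp add: cis_conv_exp c_def mult.assoc)
  qed simp
  moreover have "cis (d * (2 * pi)) = 1"
    unfolding d_def by (metis cis_multiple_2pi Ints_of_int mult.commute)
  ultimately have "((\<lambda>\<theta>. cis (d * \<theta>)) has_integral 0) {0..2 * pi}" by simp
  moreover have "cis (of_int m * \<theta>) * cis (- of_int n * \<theta>) = cis (d * \<theta>)" for \<theta>
    by (simp add: cis_mult d_def algebra_simps)
  ultimately show ?thesis
    unfolding fourier_coeff_def using False by (auto intro: integral_unique)
qed

text \<open>On the circle a real linear function is a combination of \<open>cis \<theta>\<close> and
  \<open>cis (- \<theta>)\<close>, so multiplying by it only shifts the index of the coefficients by
  one. For a product the induction hypothesis is applied to F times the first factor; this is why F
  is arbitrary and why continuity belongs to the conclusion.\<close>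

lemma fourier_coeff_mult_real_polynomial:
  fixes q :: "complex \<Rightarrow> real"
  assumes "real_polynomial_function q"
    and "continuous_on (sphere 0 1) F" "\<And>n. fourier_coeff n (\<lambda>\<theta>. F (cis \<theta>)) = 0"
  shows "continuous_on (sphere 0 1) (\<lambda>z. F z * of_real (q z))
    \<and> (\<forall>n. fourier_coeff n (\<lambda>\<theta>. F (cis \<theta>) * of_real (q (cis \<theta>))) = 0)"
  using assms
proof (induction q arbitrary: F rule: real_polynomial_function.induct)
  case (linear q)
  interpret bounded_linear q by fact
  have cF: "continuous_on {0..2 * pi} (\<lambda>\<theta>. F (cis \<theta>))"
    by (intro continuous_on_compose2[OF linear.prems(1)] continuous_intros) auto
  define A where "A = (of_real (q 1) - \<i> * of_real (q \<i>)) / 2"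
  define B where "B = (of_real (q 1) + \<i> * of_real (q \<i>)) / 2"
  have q: "of_real (q (cis \<theta>)) = A * cis \<theta> + B * cis (- \<theta>)" for \<theta>
  proof -
    have "q (cis \<theta>) = q (cos \<theta> *\<^sub>R 1 + sin \<theta> *\<^sub>R \<i>)"
      by (rule arg_cong[where f = q]) (simp add: complex_eq_iff)
    also have "\<dots> = cos \<theta> * q 1 + sin \<theta> * q \<i>" by (simp only: add scaleR real_scaleR_def)
    finally show ?thesis by (simp add: A_def B_def complex_eq_iff field_simps)
  qed
  have "fourier_coeff n (\<lambda>\<theta>. F (cis \<theta>) * of_real (q (cis \<theta>))) = 0" for n
  proof -
    have "F (cis \<theta>) * of_real (q (cis \<theta>)) * cis (- of_int n * \<theta>)
       = A * (F (cis \<theta>) * cis (- of_int (n - 1) * \<theta>)) + B * (F (cis \<theta>) * cis (- of_int (n + 1) * \<theta>))" for \<theta>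
    proof -
      have "cis (- of_int (n - 1) * \<theta>) = cis \<theta> * cis (- of_int n * \<theta>)"
        "cis (- of_int (n + 1) * \<theta>) = cis (- \<theta>) * cis (- of_int n * \<theta>)"
        by (simp_all add: cis_mult algebra_simps)
      then show ?thesis by (simp only: q) (simp add: algebra_simps)
    qed
    then have "fourier_coeff n (\<lambda>\<theta>. F (cis \<theta>) * of_real (q (cis \<theta>)))
       = integral {0..2 * pi} (\<lambda>\<theta>. A * (F (cis \<theta>) * cis (- of_int (n - 1) * \<theta>)) + B * (F (cis \<theta>) * cis (- of_int (n + 1) * \<theta>)))"
      unfolding fourier_coeff_def by simp
    also have "\<dots> = integral {0..2 * pi} (\<lambda>\<theta>. A * (F (cis \<theta>) * cis (- of_int (n - 1) * \<theta>)))
       + integral {0..2 * pi} (\<lambda>\<theta>. B * (F (cis \<theta>) * cis (- of_int (n + 1) * \<theta>)))"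
      by (intro integral_add integrable_on_mult_right fourier_coeff_integrable cF)
    also have "\<dots> = A * fourier_coeff (n - 1) (\<lambda>\<theta>. F (cis \<theta>)) + B * fourier_coeff (n + 1) (\<lambda>\<theta>. F (cis \<theta>))"
      unfolding fourier_coeff_def integral_mult_right ..
    finally show ?thesis using linear.prems(2) by simp
  qed
  then show ?case
    by (intro conjI allI continuous_on_mult linear.prems(1) continuous_on_of_real linear_continuous_on[OF linear.hyps])
next
  case (const c)
  have "fourier_coeff n (\<lambda>\<theta>. F (cis \<theta>) * of_real c) = of_real c * fourier_coeff n (\<lambda>\<theta>. F (cis \<theta>))" for n
    unfolding fourier_coeff_def by (subst integral_mult_right[symmetric]) (simp add: mult_ac)
  then show ?case using const by (auto intro!: continuous_intros)
next
  case (add f g)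
  let ?h = "\<lambda>q \<theta>. F (cis \<theta>) * complex_of_real (q (cis \<theta>))"
  have c: "continuous_on {0..2 * pi} (?h f)" "continuous_on {0..2 * pi} (?h g)"
    using add.IH(1)[OF add.prems] add.IH(2)[OF add.prems]
    by (auto intro!: continuous_on_compose2[of "sphere 0 1" "\<lambda>z. F z * of_real (f z)" _ cis]
        continuous_on_compose2[of "sphere 0 1" "\<lambda>z. F z * of_real (g z)" _ cis] continuous_on_cis continuous_on_id)
  have "fourier_coeff n (\<lambda>\<theta>. ?h f \<theta> + ?h g \<theta>) = fourier_coeff n (?h f) + fourier_coeff n (?h g)" for n
    unfolding fourier_coeff_def distrib_right by (intro integral_add fourier_coeff_integrable c)
  then show ?case
    using add.IH(1)[OF add.prems] add.IH(2)[OF add.prems]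
    by (auto simp: distrib_left intro!: continuous_on_add)
next
  case (mult f g)
  from mult.IH(1)[OF mult.prems]
  have "continuous_on (sphere 0 1) (\<lambda>z. F z * of_real (f z))"
    "\<And>n. fourier_coeff n (\<lambda>\<theta>. F (cis \<theta>) * of_real (f (cis \<theta>))) = 0" by auto
  from mult.IH(2)[OF this] show ?case by (simp add: mult.assoc)
qed

text \<open>F is orthogonal to every polynomial in the real and imaginary part of z. By
  Stone-Weierstrass such polynomials approximate the conjugate of F uniformly, so the integral of
  |F|^2 is 0. Taking F as a function on the circle builds periodicity in.\<close>

lemma fourier_coeff_eq_0_imp_eq_0:
  assumes F: "continuous_on (sphere 0 1) F" and coeff: "\<And>n. fourier_coeff n (\<lambda>\<theta>. F (cis \<theta>)) = 0"
  shows "F (cis \<theta>) = 0"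
proof -
  let ?I = "integral {0..2 * pi}"
  have cF: "continuous_on {0..2 * pi} (\<lambda>\<theta>. F (cis \<theta>))"
    by (intro continuous_on_compose2[OF F] continuous_intros) auto
  obtain M where M: "\<And>z. z \<in> sphere 0 1 \<Longrightarrow> norm (F z) \<le> M" "M > 0"
    using compact_imp_bounded[OF compact_continuous_image[OF F compact_sphere]]
    unfolding bounded_pos by (metis imageI)
  have poly0: "?I (\<lambda>\<theta>. F (cis \<theta>) * g (cis \<theta>)) = 0" if g: "polynomial_function g" for g :: "complex \<Rightarrow> complex"
  proof -
    have "real_polynomial_function (\<lambda>z. Re (g z))" "real_polynomial_function (\<lambda>z. Im (g z))"
      using g bounded_linear_Re bounded_linear_Im unfolding polynomial_function_def o_def by auto
    from this[THEN fourier_coeff_mult_real_polynomial, OF F coeff]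
    have c: "continuous_on (sphere 0 1) (\<lambda>z. F z * of_real (Re (g z)))"
      "continuous_on (sphere 0 1) (\<lambda>z. F z * of_real (Im (g z)))"
      and z: "fourier_coeff 0 (\<lambda>\<theta>. F (cis \<theta>) * of_real (Re (g (cis \<theta>)))) = 0"
      "fourier_coeff 0 (\<lambda>\<theta>. F (cis \<theta>) * of_real (Im (g (cis \<theta>)))) = 0" by blast+
    have i: "(\<lambda>\<theta>. F (cis \<theta>) * of_real (Re (g (cis \<theta>)))) integrable_on {0..2 * pi}"
      "(\<lambda>\<theta>. F (cis \<theta>) * of_real (Im (g (cis \<theta>)))) integrable_on {0..2 * pi}"
      by (intro integrable_continuous_real continuous_on_compose2[OF c(1)] continuous_on_compose2[OF c(2)] continuous_intros; auto)+
    have "?I (\<lambda>\<theta>. F (cis \<theta>) * g (cis \<theta>)) = ?I (\<lambda>\<theta>. F (cis \<theta>) * of_real (Re (g (cis \<theta>)))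
        + \<i> * (F (cis \<theta>) * of_real (Im (g (cis \<theta>)))))"
    proof (rule integral_cong)
      fix \<theta>
      have "g (cis \<theta>) = of_real (Re (g (cis \<theta>))) + \<i> * of_real (Im (g (cis \<theta>)))"
        by (rule complex_eq)
      then show "F (cis \<theta>) * g (cis \<theta>) = F (cis \<theta>) * of_real (Re (g (cis \<theta>)))
        + \<i> * (F (cis \<theta>) * of_real (Im (g (cis \<theta>))))"
        by (metis (no_types, opaque_lifting) distrib_left mult.left_commute)
    qed
    also have "\<dots> = ?I (\<lambda>\<theta>. F (cis \<theta>) * of_real (Re (g (cis \<theta>)))) + ?I (\<lambda>\<theta>. \<i> * (F (cis \<theta>) * of_real (Im (g (cis \<theta>)))))"
      by (intro integral_add integrable_on_mult_right i)
    also have "\<dots> = 0" using z by (simp add: fourier_coeff_def integral_mult_right)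
    finally show ?thesis .
  qed
  define N where "N = ?I (\<lambda>\<theta>. (norm (F (cis \<theta>)))\<^sup>2)"
  have cN: "continuous_on {0..2 * pi} (\<lambda>\<theta>. (norm (F (cis \<theta>)))\<^sup>2)"
    by (intro continuous_intros cF)
  have "N \<ge> 0" unfolding N_def by (intro integral_nonneg integrable_continuous_real cN) auto
  moreover have "N \<le> 0"
  proof (rule field_le_epsilon)
    fix e :: real assume "e > 0"
    define d where "d = e / (2 * pi * M)"
    have "d > 0" using \<open>e > 0\<close> M by (simp add: d_def)
    obtain g where g: "polynomial_function g" "\<And>z. z \<in> sphere 0 1 \<Longrightarrow> norm (cnj (F z) - g z) < d"
      using Stone_Weierstrass_polynomial_function[OF compact_sphere continuous_on_cnj[OF F] \<open>d > 0\<close>] by blast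
    have cg: "continuous_on {0..2 * pi} (\<lambda>\<theta>. g (cis \<theta>))"
      by (intro continuous_on_compose2[OF continuous_on_polymonial_function[OF g(1)]] continuous_intros) auto
    have "of_real N = ?I (\<lambda>\<theta>. complex_of_real ((norm (F (cis \<theta>)))\<^sup>2))"
      unfolding N_def
      using integral_linear[OF integrable_continuous_real[OF cN] bounded_linear_of_real[where 'a = complex]]
      by (simp add: o_def)
    also have "\<dots> = ?I (\<lambda>\<theta>. F (cis \<theta>) * cnj (F (cis \<theta>)))"
      unfolding complex_norm_square ..
    also have "\<dots> = ?I (\<lambda>\<theta>. F (cis \<theta>) * cnj (F (cis \<theta>))) - ?I (\<lambda>\<theta>. F (cis \<theta>) * g (cis \<theta>))"
      by (simp add: poly0[OF g(1)])
    also have "\<dots> = ?I (\<lambda>\<theta>. F (cis \<theta>) * (cnj (F (cis \<theta>)) - g (cis \<theta>)))"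
      unfolding right_diff_distrib
      by (rule integral_diff[symmetric]) (intro integrable_continuous_real continuous_intros cF cg)+
    finally have "norm (of_real N :: complex) = norm (?I (\<lambda>\<theta>. F (cis \<theta>) * (cnj (F (cis \<theta>)) - g (cis \<theta>))))"
      by simp
    also have "\<dots> \<le> (M * d) * (2 * pi - 0)"
    proof (rule integral_bound)
      fix \<theta>
      show "norm (F (cis \<theta>) * (cnj (F (cis \<theta>)) - g (cis \<theta>))) \<le> M * d"
        unfolding norm_mult using M g(2)[of "cis \<theta>"] by (intro mult_mono) auto
    qed (auto intro!: continuous_intros cF cg)
    also have "\<dots> = e" using M by (simp add: d_def)
    finally show "N \<le> 0 + e" by simp
  qed
  ultimately have "N = 0" by simp
  then have 0: "\<forall>\<theta>\<in>{0..2 * pi}. (norm (F (cis \<theta>)))\<^sup>2 = 0"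
    unfolding N_def by (subst (asm) integral_eq_0_iff) (use cN in auto)
  obtain \<theta>' where "\<theta>' \<in> {0..2 * pi}" "cis \<theta>' = cis \<theta>"
  proof -
    have "norm (cis \<theta>) = 1" by simp
    then obtain t where "0 \<le> t" "t < 2 * pi" "cis \<theta> = Complex (cos t) (sin t)"
      using complex_unimodular_polar by blast
    then have "t \<in> {0..2 * pi}" "cis t = cis \<theta>" by (auto simp: complex_eq_iff)
    then show ?thesis by (rule that)
  qed
  with 0 show ?thesis by fastforce
qed

section \<open>Solutions of the Helmholtz equation in polar coordinates\<close>

text \<open>Negative radii are allowed, so that functions of the radius around an interior point
  have two-sided derivatives at 0.\<close>

definition polar :: "real^2 \<Rightarrow> real \<Rightarrow> real \<Rightarrow> real^2" where
  "polar p r \<theta> = p + (r * cos \<theta>) *\<^sub>R axis 1 1 + (r * sin \<theta>) *\<^sub>R axis 2 1"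

lemma axis_2_nth [simp]:
  "(axis 1 c :: 'a::zero^2) $ 1 = c" "(axis 1 c :: 'a::zero^2) $ 2 = 0"
  "(axis 2 c :: 'a::zero^2) $ 1 = 0" "(axis 2 c :: 'a::zero^2) $ 2 = c"
  by (simp_all add: axis_def)

lemma polar_nth [simp]: "polar p r \<theta> $ 1 = p $ 1 + r * cos \<theta>" "polar p r \<theta> $ 2 = p $ 2 + r * sin \<theta>"
  by (simp_all add: polar_def)

lemma norm_vec_2: "norm (x :: real^2) = sqrt ((x $ 1)\<^sup>2 + (x $ 2)\<^sup>2)"
  by (simp add: norm_vec_def L2_set_def sum_2)

lemma dist_polar: "dist p (polar p r \<theta>) = \<bar>r\<bar>"
proof -
  have "norm (polar p r \<theta> - p) = sqrt (r\<^sup>2 * ((cos \<theta>)\<^sup>2 + (sin \<theta>)\<^sup>2))"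
    by (simp add: norm_vec_2 power_mult_distrib distrib_left del: sin_cos_squared_add2)
  then have "norm (polar p r \<theta> - p) = \<bar>r\<bar>" by simp
  then show ?thesis by (simp add: dist_norm norm_minus_commute)
qed

lemma polar_exists: obtains r \<theta> where "r \<ge> 0" "x = polar p r \<theta>"
proof -
  define z where "z = Complex (x $ 1 - p $ 1) (x $ 2 - p $ 2)"
  have "z = rcis (norm z) (Arg z)" by (simp add: rcis_cmod_Arg)
  then have "Re z = norm z * cos (Arg z)" "Im z = norm z * sin (Arg z)"
    by (metis Re_rcis, metis Im_rcis)
  then have "x = polar p (norm z) (Arg z)"
    by (simp add: vec_eq_iff forall_2 z_def)
  then show ?thesis by (rule that[rotated]) simp
qed

lemma continuous_on_polar [continuous_intros]:
  fixes A :: "'a::t2_space set"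
  assumes "continuous_on A r" "continuous_on A \<theta>"
  shows "continuous_on A (\<lambda>x. polar p (r x) (\<theta> x))"
  unfolding polar_def by (intro continuous_intros assms)

lemma has_vector_derivative_polar_radius:
  "((\<lambda>r. polar p r \<theta>) has_vector_derivative (cos \<theta> *\<^sub>R axis 1 1 + sin \<theta> *\<^sub>R axis 2 1)) (at r)"
  unfolding polar_def by (auto intro!: derivative_eq_intros)

lemma has_vector_derivative_polar_angle:
  "((\<lambda>\<theta>. polar p r \<theta>) has_vector_derivative (- (r * sin \<theta>) *\<^sub>R axis 1 1 + (r * cos \<theta>) *\<^sub>R axis 2 1)) (at \<theta>)"
  unfolding polar_def by (auto intro!: derivative_eq_intros simp: mult.commute)

lemma has_vector_derivative_chain_at:
  assumes "(c has_vector_derivative v) (at t)" "(f has_derivative F) (at (c t))"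
  shows "((\<lambda>t. f (c t)) has_vector_derivative F v) (at t)"
proof -
  interpret F: bounded_linear F using assms(2) by (rule has_derivative_bounded_linear)
  have "((\<lambda>t. f (c t)) has_derivative (\<lambda>x. F (x *\<^sub>R v))) (at t)"
    using has_derivative_compose[OF assms(1)[unfolded has_vector_derivative_def] assms(2)] .
  then show ?thesis by (simp add: has_vector_derivative_def F.scaleR)
qed

text \<open>The gradient \<open>g\<close> and the Hessian \<open>H\<close> are parameters instead of
  being written with \<open>partial_deriv\<close>. Differences and real-linear images of solutions
  are then instances without any computation of partial derivatives.\<close>

locale planar_helmholtz =
  fixes \<kappa> :: real and U :: "(real^2) set" and f :: "real^2 \<Rightarrow> complex"
    and g :: "2 \<Rightarrow> real^2 \<Rightarrow> complex" and H :: "2 \<Rightarrow> 2 \<Rightarrow> real^2 \<Rightarrow> complex"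
  assumes open_U: "open U"
    and f_deriv: "\<And>x. x \<in> U \<Longrightarrow> (f has_derivative (\<lambda>h. h $ 1 *\<^sub>R g 1 x + h $ 2 *\<^sub>R g 2 x)) (at x)"
    and g_deriv: "\<And>i x. x \<in> U \<Longrightarrow> (g i has_derivative (\<lambda>h. h $ 1 *\<^sub>R H i 1 x + h $ 2 *\<^sub>R H i 2 x)) (at x)"
    and H_cont: "\<And>i j. continuous_on U (H i j)"
    and helmholtz_eq: "\<And>x. x \<in> U \<Longrightarrow> H 1 1 x + H 2 2 x = - (\<kappa>\<^sup>2 *\<^sub>R f x)"
begin

lemma f_cont: "continuous_on U f"
  using f_deriv by (intro continuous_at_imp_continuous_on) (auto intro: has_derivative_continuous)

lemma g_cont: "continuous_on U (g i)"
  using g_deriv by (intro continuous_at_imp_continuous_on) (auto intro: has_derivative_continuous)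

end

text \<open>\<open>I\<close> is an interval of radii whose circles around \<open>p\<close> lie in
  \<open>U\<close>. It is used with a neighbourhood of 0 around interior points and with a half-line
  around the origin.\<close>

locale planar_helmholtz_polar = planar_helmholtz +
  fixes p :: "real^2" and I :: "real set"
  assumes I: "open I" "convex I" and polar_in_U: "\<And>r \<theta>. r \<in> I \<Longrightarrow> polar p r \<theta> \<in> U"
begin

definition radial :: "real \<Rightarrow> real \<Rightarrow> complex" where
  "radial r \<theta> = cos \<theta> *\<^sub>R g 1 (polar p r \<theta>) + sin \<theta> *\<^sub>R g 2 (polar p r \<theta>)"

definition radial2 :: "real \<Rightarrow> real \<Rightarrow> complex" where
  "radial2 r \<theta> = cos \<theta> *\<^sub>R (cos \<theta> *\<^sub>R H 1 1 (polar p r \<theta>) + sin \<theta> *\<^sub>R H 1 2 (polar p r \<theta>))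
     + sin \<theta> *\<^sub>R (cos \<theta> *\<^sub>R H 2 1 (polar p r \<theta>) + sin \<theta> *\<^sub>R H 2 2 (polar p r \<theta>))"

definition angular :: "real \<Rightarrow> real \<Rightarrow> complex" where
  "angular r \<theta> = (- (r * sin \<theta>)) *\<^sub>R g 1 (polar p r \<theta>) + (r * cos \<theta>) *\<^sub>R g 2 (polar p r \<theta>)"

text \<open>The term with \<open>radial\<close> comes from differentiating the factors sin and cos
  in \<open>angular\<close>; the rest is the Hessian applied twice to the tangent vector of the
  circle.\<close>

definition angular2 :: "real \<Rightarrow> real \<Rightarrow> complex" where
  "angular2 r \<theta> = - r *\<^sub>R radial r \<theta>
     + (- (r * sin \<theta>)) *\<^sub>R ((- (r * sin \<theta>)) *\<^sub>R H 1 1 (polar p r \<theta>) + (r * cos \<theta>) *\<^sub>R H 1 2 (polar p r \<theta>))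
     + (r * cos \<theta>) *\<^sub>R ((- (r * sin \<theta>)) *\<^sub>R H 2 1 (polar p r \<theta>) + (r * cos \<theta>) *\<^sub>R H 2 2 (polar p r \<theta>))"

lemma f_polar_radius: "r \<in> I \<Longrightarrow> ((\<lambda>r. f (polar p r \<theta>)) has_vector_derivative radial r \<theta>) (at r)"
  using has_vector_derivative_chain_at[OF has_vector_derivative_polar_radius f_deriv[OF polar_in_U]]
  by (simp add: radial_def)

lemma g_polar_radius: "r \<in> I \<Longrightarrow> ((\<lambda>r. g i (polar p r \<theta>)) has_vector_derivative
    (cos \<theta> *\<^sub>R H i 1 (polar p r \<theta>) + sin \<theta> *\<^sub>R H i 2 (polar p r \<theta>))) (at r)"
  using has_vector_derivative_chain_at[OF has_vector_derivative_polar_radius g_deriv[OF polar_in_U]]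
  by simp

lemma radial_radius: "r \<in> I \<Longrightarrow> ((\<lambda>r. radial r \<theta>) has_vector_derivative radial2 r \<theta>) (at r)"
  unfolding radial_def radial2_def
  by (intro has_vector_derivative_add bounded_linear.has_vector_derivative[OF bounded_linear_scaleR_right] g_polar_radius)

lemma f_polar_angle: "r \<in> I \<Longrightarrow> ((\<lambda>\<theta>. f (polar p r \<theta>)) has_vector_derivative angular r \<theta>) (at \<theta>)"
  using has_vector_derivative_chain_at[OF has_vector_derivative_polar_angle f_deriv[OF polar_in_U]]
  by (simp add: angular_def)

lemma g_polar_angle: "r \<in> I \<Longrightarrow> ((\<lambda>\<theta>. g i (polar p r \<theta>)) has_vector_derivative
    ((- (r * sin \<theta>)) *\<^sub>R H i 1 (polar p r \<theta>) + (r * cos \<theta>) *\<^sub>R H i 2 (polar p r \<theta>))) (at \<theta>)"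
  using has_vector_derivative_chain_at[OF has_vector_derivative_polar_angle g_deriv[OF polar_in_U]]
  by simp

lemma angular_angle:
  assumes "r \<in> I"
  shows "((\<lambda>\<theta>. angular r \<theta>) has_vector_derivative angular2 r \<theta>) (at \<theta>)"
proof -
  have 1: "((\<lambda>\<theta>. - (r * sin \<theta>)) has_real_derivative - (r * cos \<theta>)) (at \<theta>)"
    by (auto intro!: derivative_eq_intros)
  have 2: "((\<lambda>\<theta>. r * cos \<theta>) has_real_derivative - (r * sin \<theta>)) (at \<theta>)"
    by (auto intro!: derivative_eq_intros)
  show ?thesis
    unfolding angular_def
    by (rule has_vector_derivative_eq_rhs[OF has_vector_derivative_add[OF
        has_vector_derivative_scaleR[OF 1 g_polar_angle[OF assms]]
        has_vector_derivative_scaleR[OF 2 g_polar_angle[OF assms]]]])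
      (simp add: angular2_def radial_def algebra_simps)
qed

lemma continuous_on_polar_comp:
  fixes A :: "'b::t2_space set"
  assumes "continuous_on U h" "continuous_on A r" "continuous_on A \<theta>" "\<And>x. x \<in> A \<Longrightarrow> r x \<in> I"
  shows "continuous_on A (\<lambda>x. h (polar p (r x) (\<theta> x)))"
  by (rule continuous_on_compose2[OF assms(1)]) (use assms polar_in_U in \<open>auto intro!: continuous_intros\<close>)

lemma continuous_on_radial:
  fixes A :: "'b::t2_space set"
  assumes "continuous_on A r" "continuous_on A \<theta>" "\<And>x. x \<in> A \<Longrightarrow> r x \<in> I"
  shows "continuous_on A (\<lambda>x. radial (r x) (\<theta> x))" "continuous_on A (\<lambda>x. radial2 (r x) (\<theta> x))"
  unfolding radial_def radial2_def
  by (intro continuous_on_add continuous_on_scaleR continuous_on_minus continuous_on_mult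
    continuous_on_sin continuous_on_cos continuous_on_polar_comp[OF g_cont] continuous_on_polar_comp[OF H_cont] assms; assumption)+

lemma f_polar_cont: "r \<in> I \<Longrightarrow> continuous_on A (\<lambda>\<theta>. f (polar p r \<theta>))"
  by (intro continuous_on_polar_comp[OF f_cont] continuous_intros) auto

definition coeff :: "int \<Rightarrow> real \<Rightarrow> complex" where
  "coeff n r = fourier_coeff n (\<lambda>\<theta>. f (polar p r \<theta>))"

definition coeff' :: "int \<Rightarrow> real \<Rightarrow> complex" where
  "coeff' n r = fourier_coeff n (radial r)"

lemma fourier_coeff_has_vector_derivative:
  assumes "\<And>r \<theta>. r \<in> I \<Longrightarrow> ((\<lambda>r. u r \<theta>) has_vector_derivative v r \<theta>) (at r)"
    and "\<And>r. r \<in> I \<Longrightarrow> continuous_on {0..2 * pi} (u r)"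
    and "continuous_on (I \<times> {0..2 * pi}) (\<lambda>(r, \<theta>). v r \<theta>)" and r: "r \<in> I"
  shows "((\<lambda>r. fourier_coeff n (u r)) has_vector_derivative fourier_coeff n (v r)) (at r)"
proof -
  have "((\<lambda>r. integral (cbox 0 (2 * pi)) (\<lambda>\<theta>. u r \<theta> * cis (- of_int n * \<theta>))) has_vector_derivative
      integral (cbox 0 (2 * pi)) (\<lambda>\<theta>. v r \<theta> * cis (- of_int n * \<theta>))) (at r within I)"
  proof (rule leibniz_rule_vector_derivative[where U = I and f = "\<lambda>r \<theta>. u r \<theta> * cis (- of_int n * \<theta>)"
        and fx = "\<lambda>r \<theta>. v r \<theta> * cis (- of_int n * \<theta>)"])
    show "((\<lambda>r. u r t * cis (- of_int n * t)) has_vector_derivative v x t * cis (- of_int n * t)) (at x within I)"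
      if "x \<in> I" for x t
      by (rule has_vector_derivative_mult_left[OF has_vector_derivative_at_within[OF assms(1)[OF that]]])
    show "(\<lambda>\<theta>. u x \<theta> * cis (- of_int n * \<theta>)) integrable_on cbox 0 (2 * pi)" if "x \<in> I" for x
      using fourier_coeff_integrable[OF assms(2)[OF that]] by simp
    have "continuous_on (I \<times> {0..2 * pi}) (\<lambda>x. (\<lambda>(r, \<theta>). v r \<theta>) x * cis (- of_int n * snd x))"
      by (rule continuous_on_mult[OF assms(3)]) (intro continuous_intros)
    also have "(\<lambda>x. (\<lambda>(r, \<theta>). v r \<theta>) x * cis (- of_int n * snd x)) = (\<lambda>(r, \<theta>). v r \<theta> * cis (- of_int n * \<theta>))"
      by (simp only: fun_eq_iff split_paired_all case_prod_conv snd_conv) simp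
    finally show "continuous_on (I \<times> cbox 0 (2 * pi)) (\<lambda>(r, \<theta>). v r \<theta> * cis (- of_int n * \<theta>))"
      by (simp only: cbox_interval)
  qed (rule r, rule I)
  then show ?thesis
    unfolding fourier_coeff_def using at_within_open[OF r I(1)] by simp
qed

lemma coeff_deriv: "r \<in> I \<Longrightarrow> (coeff n has_vector_derivative coeff' n r) (at r)"
  unfolding coeff_def[abs_def] coeff'_def
proof (rule fourier_coeff_has_vector_derivative)
  have "continuous_on (I \<times> {0..2 * pi}) (\<lambda>x. radial (fst x) (snd x))"
    by (intro continuous_on_radial continuous_intros) auto
  then show "continuous_on (I \<times> {0..2 * pi}) (\<lambda>(r, \<theta>). radial r \<theta>)"
    by (simp add: case_prod_beta)
qed (auto intro: f_polar_radius f_polar_cont)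

lemma coeff'_deriv: "r \<in> I \<Longrightarrow> (coeff' n has_vector_derivative fourier_coeff n (radial2 r)) (at r)"
  unfolding coeff'_def[abs_def]
proof (rule fourier_coeff_has_vector_derivative)
  have "continuous_on (I \<times> {0..2 * pi}) (\<lambda>x. radial2 (fst x) (snd x))"
    by (intro continuous_on_radial continuous_intros) auto
  then show "continuous_on (I \<times> {0..2 * pi}) (\<lambda>(r, \<theta>). radial2 r \<theta>)"
    by (simp add: case_prod_beta)
  show "continuous_on {0..2 * pi} (radial r)" if "r \<in> I" for r
    using continuous_on_radial(1)[of "{0..2*pi}" "\<lambda>_. r" "\<lambda>\<theta>. \<theta>"] that by (simp add: continuous_on_id)
qed (auto intro: radial_radius)

text \<open>The mixed entries of the Hessian cancel between \<open>radial2\<close> and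
  \<open>angular2\<close>, and so do the first-order terms. The factor r^2 lets the identity hold at
  radius 0 too.\<close>

lemma polar_laplacian:
  assumes "r \<in> I"
  shows "r\<^sup>2 *\<^sub>R radial2 r \<theta> + r *\<^sub>R radial r \<theta> + angular2 r \<theta> = - ((\<kappa> * r)\<^sup>2 *\<^sub>R f (polar p r \<theta>))"
proof -
  let ?x = "polar p r \<theta>"
  define c s where "c = cos \<theta>" and "s = sin \<theta>"
  have "r\<^sup>2 *\<^sub>R radial2 r \<theta> + r *\<^sub>R radial r \<theta> + angular2 r \<theta>
     = (r\<^sup>2 * (c\<^sup>2 + s\<^sup>2)) *\<^sub>R (H 1 1 ?x + H 2 2 ?x)"
    unfolding radial2_def angular2_def c_def[symmetric] s_def[symmetric] by (simp add: algebra_simps power2_eq_square)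
  also have "\<dots> = r\<^sup>2 *\<^sub>R (- (\<kappa>\<^sup>2 *\<^sub>R f ?x))"
    using helmholtz_eq[OF polar_in_U[OF assms]] by (simp add: c_def s_def)
  finally show ?thesis by (simp add: power_mult_distrib mult.commute)
qed

lemma fourier_coeff_angular2:
  assumes r: "r \<in> I"
  shows "((\<lambda>\<theta>. angular2 r \<theta> * cis (- of_int n * \<theta>)) has_integral - (of_int n)\<^sup>2 * coeff n r) {0..2 * pi}"
proof -
  define e where "e = (\<lambda>\<theta>. cis (- of_int n * \<theta>))"
  \<comment> \<open>Two integrations by parts in one: with u the restriction of f to the circle,
    this is u' e - u e', whose derivative is u'' e - u e'' and e'' = - n^2 e. Its boundary values
    cancel by periodicity.\<close>
  define P where "P = (\<lambda>\<theta>. angular r \<theta> * e \<theta> + f (polar p r \<theta>) * (\<i> * of_int n * e \<theta>))"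
  have e: "(e has_vector_derivative - (\<i> * of_int n * e \<theta>)) (at \<theta>)" for \<theta>
  proof -
    define c where "c = - \<i> * of_int n"
    have "((\<lambda>z. exp (c * z)) has_field_derivative c * exp (c * of_real \<theta>)) (at (of_real \<theta>))"
      by (auto intro!: derivative_eq_intros)
    from has_vector_derivative_real_field[OF this] show ?thesis
      unfolding e_def c_def by (simp add: cis_conv_exp mult.assoc)
  qed
  have P: "(P has_vector_derivative (angular2 r \<theta> * e \<theta> + (of_int n)\<^sup>2 * (f (polar p r \<theta>) * e \<theta>))) (at \<theta>)" for \<theta>
    unfolding P_def
    by (rule has_vector_derivative_eq_rhs[OF has_vector_derivative_add[OF
        has_vector_derivative_mult[OF angular_angle[OF r] e]
        has_vector_derivative_mult[OF f_polar_angle[OF r] bounded_linear.has_vector_derivative[OF bounded_linear_mult_right e]]]])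
      (simp add: algebra_simps power2_eq_square)
  have "((\<lambda>\<theta>. angular2 r \<theta> * e \<theta> + (of_int n)\<^sup>2 * (f (polar p r \<theta>) * e \<theta>)) has_integral (P (2 * pi) - P 0)) {0..2 * pi}"
    by (rule fundamental_theorem_of_calculus[OF _ has_vector_derivative_at_within[OF P]]) simp
  moreover have "((\<lambda>\<theta>. (of_int n)\<^sup>2 * (f (polar p r \<theta>) * e \<theta>)) has_integral (of_int n)\<^sup>2 * coeff n r) {0..2 * pi}"
    unfolding coeff_def fourier_coeff_def e_def
    by (rule has_integral_mult_right[OF integrable_integral[OF fourier_coeff_integrable[OF f_polar_cont[OF r]]]])
  ultimately have "((\<lambda>\<theta>. angular2 r \<theta> * e \<theta> + (of_int n)\<^sup>2 * (f (polar p r \<theta>) * e \<theta>)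
      - (of_int n)\<^sup>2 * (f (polar p r \<theta>) * e \<theta>)) has_integral (P (2 * pi) - P 0 - (of_int n)\<^sup>2 * coeff n r)) {0..2 * pi}"
    by (rule has_integral_diff)
  moreover have "P (2 * pi) = P 0"
  proof -
    have "cis (2 * pi * of_int (- n)) = 1" by (rule cis_multiple_2pi) simp
    then have "e (2 * pi) = e 0" by (simp add: e_def mult.commute)
    then show ?thesis by (simp add: P_def angular_def polar_def)
  qed
  ultimately show ?thesis by (simp add: e_def)
qed

text \<open>\<open>polar_laplacian\<close> integrated against
  \<open>cis (- of_int n * \<theta>)\<close>, where the angular part turns into - n^2 times the
  coefficient.\<close>

lemma coeff_bessel:
  assumes r: "r \<in> I" "r \<noteq> 0"
  shows "(coeff' n has_vector_derivative (- coeff' n r /\<^sub>R r - (\<kappa>\<^sup>2 - (of_int n)\<^sup>2 / r\<^sup>2) *\<^sub>R coeff n r)) (at r)"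
proof -
  let ?e = "\<lambda>\<theta>. cis (- of_int n * \<theta>)"
  have c: "continuous_on {0..2 * pi} (radial r)" "continuous_on {0..2 * pi} (radial2 r)"
    using continuous_on_radial[of "{0..2*pi}" "\<lambda>_. r" "\<lambda>\<theta>. \<theta>"] r by (simp_all add: continuous_on_id)
  have "angular2 r \<theta> * ?e \<theta> = - ((\<kappa> * r)\<^sup>2 *\<^sub>R (f (polar p r \<theta>) * ?e \<theta>))
     - r\<^sup>2 *\<^sub>R (radial2 r \<theta> * ?e \<theta>) - r *\<^sub>R (radial r \<theta> * ?e \<theta>)" for \<theta>
  proof -
    have "angular2 r \<theta> = - ((\<kappa> * r)\<^sup>2 *\<^sub>R f (polar p r \<theta>)) - r\<^sup>2 *\<^sub>R radial2 r \<theta> - r *\<^sub>R radial r \<theta>"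
      using polar_laplacian[OF r(1), of \<theta>] by (simp add: algebra_simps eq_neg_iff_add_eq_0)
    then show ?thesis by (simp only: left_diff_distrib mult_minus_left mult_scaleR_left)
  qed
  moreover have "((\<lambda>\<theta>. - ((\<kappa> * r)\<^sup>2 *\<^sub>R (f (polar p r \<theta>) * ?e \<theta>))
     - r\<^sup>2 *\<^sub>R (radial2 r \<theta> * ?e \<theta>) - r *\<^sub>R (radial r \<theta> * ?e \<theta>)) has_integral
      (- ((\<kappa> * r)\<^sup>2 *\<^sub>R coeff n r) - r\<^sup>2 *\<^sub>R fourier_coeff n (radial2 r) - r *\<^sub>R coeff' n r)) {0..2 * pi}"
    unfolding coeff_def coeff'_def fourier_coeff_def
    by (intro has_integral_diff has_integral_neg has_integral_cmul integrable_integral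
        fourier_coeff_integrable f_polar_cont c r)
  ultimately have "- (of_int n)\<^sup>2 * coeff n r
      = - ((\<kappa> * r)\<^sup>2 *\<^sub>R coeff n r) - r\<^sup>2 *\<^sub>R fourier_coeff n (radial2 r) - r *\<^sub>R coeff' n r"
    using has_integral_unique[OF fourier_coeff_angular2[OF r(1), of n]] by simp
  then have "fourier_coeff n (radial2 r) = - coeff' n r /\<^sub>R r - (\<kappa>\<^sup>2 - (of_int n)\<^sup>2 / r\<^sup>2) *\<^sub>R coeff n r"
    using r(2) by (simp add: scaleR_conv_of_real field_simps power2_eq_square)
  then show ?thesis using coeff'_deriv[OF r(1), of n] by simp
qed

end

text \<open>Termwise integration under the Weierstrass test; it is what identifies the Fourier
  coefficients of the series in the local expansion.\<close>

lemma fourier_coeff_suminf: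
  fixes h :: "nat \<Rightarrow> complex \<Rightarrow> complex"
  assumes cont: "\<And>k. continuous_on (sphere 0 1) (h k)"
    and bound: "\<And>k z. z \<in> sphere 0 1 \<Longrightarrow> norm (h k z) \<le> M k" and M: "summable M"
  shows "continuous_on (sphere 0 1) (\<lambda>z. \<Sum>k. h k z)"
    and "(\<lambda>k. fourier_coeff n (\<lambda>\<theta>. h k (cis \<theta>))) sums fourier_coeff n (\<lambda>\<theta>. \<Sum>k. h k (cis \<theta>))"
proof -
  have ul: "uniform_limit (sphere 0 1) (\<lambda>N z. \<Sum>k<N. h k z) (\<lambda>z. \<Sum>k. h k z) sequentially"
    using bound M by (rule Weierstrass_m_test)
  show "continuous_on (sphere 0 1) (\<lambda>z. \<Sum>k. h k z)"
    by (rule uniform_limit_theorem[OF _ ul]) (auto intro!: always_eventually continuous_on_sum cont)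
  have cont': "continuous_on {0..2 * pi} (\<lambda>\<theta>. h k (cis \<theta>))" for k
    by (rule continuous_on_compose2[OF cont]) (auto intro!: continuous_intros)
  have bound': "norm (h k (cis \<theta>) * cis (- of_int n * \<theta>)) \<le> M k" for k \<theta>
    using bound[of "cis \<theta>" k] by (simp add: norm_mult)
  have summ: "summable (\<lambda>k. h k (cis \<theta>))" for \<theta>
    by (rule summable_comparison_test'[OF M, of 0]) (use bound[of "cis \<theta>"] in auto)
  have "uniform_limit {0..2 * pi} (\<lambda>N \<theta>. \<Sum>k<N. h k (cis \<theta>) * cis (- of_int n * \<theta>))
      (\<lambda>\<theta>. \<Sum>k. h k (cis \<theta>) * cis (- of_int n * \<theta>)) sequentially"
    using bound' M by (rule Weierstrass_m_test)
  then obtain I J where IJ: "\<And>N. ((\<lambda>\<theta>. \<Sum>k<N. h k (cis \<theta>) * cis (- of_int n * \<theta>)) has_integral I N) {0..2 * pi}"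
    "((\<lambda>\<theta>. \<Sum>k. h k (cis \<theta>) * cis (- of_int n * \<theta>)) has_integral J) {0..2 * pi}" "I \<longlonglongrightarrow> J"
    by (rule uniform_limit_integral) (auto intro!: continuous_intros cont')
  have "I N = (\<Sum>k<N. fourier_coeff n (\<lambda>\<theta>. h k (cis \<theta>)))" for N
  proof (rule has_integral_unique[OF IJ(1)])
    show "((\<lambda>\<theta>. \<Sum>k<N. h k (cis \<theta>) * cis (- of_int n * \<theta>)) has_integral
        (\<Sum>k<N. fourier_coeff n (\<lambda>\<theta>. h k (cis \<theta>)))) {0..2 * pi}"
      unfolding fourier_coeff_def
      by (intro has_integral_sum integrable_integral fourier_coeff_integrable cont') auto
  qed
  then have "I = (\<lambda>N. \<Sum>k<N. fourier_coeff n (\<lambda>\<theta>. h k (cis \<theta>)))" by blast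
  moreover have "J = fourier_coeff n (\<lambda>\<theta>. \<Sum>k. h k (cis \<theta>))"
    unfolding fourier_coeff_def suminf_mult2[OF summ] by (rule integral_unique[OF IJ(2), symmetric])
  ultimately show "(\<lambda>k. fourier_coeff n (\<lambda>\<theta>. h k (cis \<theta>))) sums fourier_coeff n (\<lambda>\<theta>. \<Sum>k. h k (cis \<theta>))"
    using IJ(3) by (simp add: sums_def)
qed

lemma has_real_derivative_Re_Im:
  assumes "(h has_vector_derivative v) (at x)"
  shows "((\<lambda>x. Re (h x)) has_real_derivative Re v) (at x)" "((\<lambda>x. Im (h x)) has_real_derivative Im v) (at x)"
  using bounded_linear.has_vector_derivative[OF bounded_linear_Re assms]
    bounded_linear.has_vector_derivative[OF bounded_linear_Im assms]
  by (simp_all add: has_real_derivative_iff_has_vector_derivative)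

context planar_helmholtz_polar
begin

lemma Re_Im_coeff_deriv:
  assumes "r \<in> I"
  shows "((\<lambda>r. Re (coeff n r)) has_real_derivative Re (coeff' n r)) (at r)"
    "((\<lambda>r. Im (coeff n r)) has_real_derivative Im (coeff' n r)) (at r)"
  using has_real_derivative_Re_Im[OF coeff_deriv[OF assms]] by auto

text \<open>Bessel's equation has real coefficients, so both parts solve it separately. The variable
  \<open>m\<close> lets the square of the order be written with the integer n or with
  \<open>nat \<bar>n\<bar>\<close>.\<close>

lemma Re_Im_coeff_bessel:
  assumes "r \<in> I" "r \<noteq> 0" and m: "(of_int n)\<^sup>2 = m"
  shows "((\<lambda>r. Re (coeff' n r)) has_real_derivative (- Re (coeff' n r) / r - (\<kappa>\<^sup>2 - m / r\<^sup>2) * Re (coeff n r))) (at r)"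
    "((\<lambda>r. Im (coeff' n r)) has_real_derivative (- Im (coeff' n r) / r - (\<kappa>\<^sup>2 - m / r\<^sup>2) * Im (coeff n r))) (at r)"
  using has_real_derivative_Re_Im[OF coeff_bessel[OF assms(1,2), of n]]
  unfolding m by (simp_all add: divide_inverse mult.commute)

lemma radial_cont: "r \<in> I \<Longrightarrow> continuous_on {0..2 * pi} (radial r)"
  using continuous_on_radial(1)[of "{0..2*pi}" "\<lambda>_. r" "\<lambda>\<theta>. \<theta>"] by (simp add: continuous_on_id)

text \<open>\<open>K\<close> is the candidate for f on the circle: 0 for the behaviour at infinity,
  the sum of the Bessel series for the local expansion.\<close>

lemma eq_if_coeff_eq:
  assumes r: "r \<in> I" and K: "continuous_on (sphere 0 1) K"
    and coeff: "\<And>n. fourier_coeff n (\<lambda>\<theta>. K (cis \<theta>)) = coeff n r"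
  shows "f (polar p r \<theta>) = K (cis \<theta>)"
proof -
  \<comment> \<open>The circle of radius r parametrised by z on the unit circle instead of by the
    angle, as the uniqueness result for Fourier coefficients requires.\<close>
  define P where "P = (\<lambda>z. p + (r * Re z) *\<^sub>R axis 1 1 + (r * Im z) *\<^sub>R axis 2 (1::real))"
  have P: "P (cis \<theta>) = polar p r \<theta>" for \<theta> by (simp add: P_def polar_def)
  have PU: "P z \<in> U" if "z \<in> sphere 0 1" for z
  proof -
    have "z = cis (Arg z)" using that by (metis complex_norm_eq_1_exp cis_conv_exp mem_sphere_0 rcis_cmod_Arg rcis_def mult_1 of_real_1)
    then show ?thesis using P polar_in_U[OF r] by metis
  qed
  have fP: "continuous_on (sphere 0 1) (\<lambda>z. f (P z))"
  proof (rule continuous_on_compose2[OF f_cont])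
    show "continuous_on (sphere 0 1) P" unfolding P_def by (intro continuous_intros)
  qed (use PU in auto)
  have cK: "continuous_on {0..2 * pi} (\<lambda>\<theta>. K (cis \<theta>))"
    by (rule continuous_on_compose2[OF K]) (auto intro!: continuous_intros)
  have "f (P (cis \<theta>)) - K (cis \<theta>) = 0"
  proof (rule fourier_coeff_eq_0_imp_eq_0[where F = "\<lambda>z. f (P z) - K z"])
    show "continuous_on (sphere 0 1) (\<lambda>z. f (P z) - K z)" by (intro continuous_intros fP K)
    show "fourier_coeff n (\<lambda>\<theta>. f (P (cis \<theta>)) - K (cis \<theta>)) = 0" for n
      unfolding P fourier_coeff_diff[OF f_polar_cont[OF r] cK] coeff by (simp add: coeff_def)
  qed
  then show ?thesis unfolding P by simp
qed

end

lemma fourier_coeff_scaleR: "fourier_coeff n (\<lambda>\<theta>. c *\<^sub>R h \<theta>) = c *\<^sub>R fourier_coeff n h"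
  unfolding fourier_coeff_def by simp

section \<open>Rellich's lemma\<close>

context planar_helmholtz
begin

text \<open>A Fourier coefficient is at most 2 pi times the maximum on the circle, so decay that is
  uniform in the angle passes to every coefficient, where \<open>bessel_decay_zero\<close>
  applies.\<close>

lemma rellich:
  assumes \<kappa>: "\<kappa> > 0" and R: "R \<ge> 0" "\<And>x. norm x > R \<Longrightarrow> x \<in> U"
    and f0: "\<And>e. e > 0 \<Longrightarrow> \<forall>\<^sub>F r in at_top. \<forall>\<theta>. norm (sqrt r *\<^sub>R f (polar 0 r \<theta>)) < e"
    and g0: "\<And>e. e > 0 \<Longrightarrow> \<forall>\<^sub>F r in at_top. \<forall>\<theta>.
      norm (sqrt r *\<^sub>R (cos \<theta> *\<^sub>R g 1 (polar 0 r \<theta>) + sin \<theta> *\<^sub>R g 2 (polar 0 r \<theta>))) < e"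
    and x: "norm x > R"
  shows "f x = 0"
proof -
  interpret planar_helmholtz_polar \<kappa> U f g H 0 "{R<..}"
  proof
    fix r \<theta> assume "r \<in> {R<..}"
    then show "polar 0 r \<theta> \<in> U" using R dist_polar[of 0 r \<theta>] by (intro R(2)) auto
  qed auto
  have lim: "((\<lambda>r. sqrt r *\<^sub>R fourier_coeff n (h r)) \<longlongrightarrow> 0) at_top"
    if c: "\<And>r. r > R \<Longrightarrow> continuous_on {0..2 * pi} (h r)"
      and h: "\<And>e. e > 0 \<Longrightarrow> \<forall>\<^sub>F r in at_top. \<forall>\<theta>. norm (sqrt r *\<^sub>R h r \<theta>) < e" for h n
  proof (rule tendstoI)
    fix e :: real assume e: "e > 0"
    \<comment> \<open>The bound for the coefficient costs a factor 2 pi, which leaves e / 2.\<close>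
    then have "e / (4 * pi) > 0" by simp
    from h[OF this] eventually_gt_at_top[of R]
    show "\<forall>\<^sub>F r in at_top. dist (sqrt r *\<^sub>R fourier_coeff n (h r)) 0 < e"
    proof eventually_elim
      case (elim r)
      have "norm (fourier_coeff n (\<lambda>\<theta>. sqrt r *\<^sub>R h r \<theta>)) \<le> 2 * pi * (e / (4 * pi))"
        by (rule norm_fourier_coeff_le) (use elim c in \<open>auto intro!: continuous_intros less_imp_le\<close>)
      also have "\<dots> < e" using e by simp
      finally show ?case by (simp add: fourier_coeff_scaleR)
    qed
  qed
  have lc: "((\<lambda>r. sqrt r *\<^sub>R coeff n r) \<longlongrightarrow> 0) at_top" for n
    unfolding coeff_def by (rule lim[OF f_polar_cont f0]) auto
  have lc': "((\<lambda>r. sqrt r *\<^sub>R coeff' n r) \<longlongrightarrow> 0) at_top" for n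
    unfolding coeff'_def by (rule lim[OF radial_cont]) (use g0 in \<open>auto simp: radial_def\<close>)
  have "coeff n r = 0" if "r > R" for n r
  proof (rule complex_eqI)
    have "Re (coeff n r) = 0"
      using tendsto_Re[OF lc[of n]] tendsto_Re[OF lc'[of n]] that
      by (intro bessel_decay_zero[OF \<kappa> R(1), of _ "\<lambda>r. Re (coeff' n r)" "(of_int n)\<^sup>2"] Re_Im_coeff_deriv Re_Im_coeff_bessel)
        (use R in auto)
    then show "Re (coeff n r) = Re 0" by simp
    have "Im (coeff n r) = 0"
      using tendsto_Im[OF lc[of n]] tendsto_Im[OF lc'[of n]] that
      by (intro bessel_decay_zero[OF \<kappa> R(1), of _ "\<lambda>r. Im (coeff' n r)" "(of_int n)\<^sup>2"] Re_Im_coeff_deriv Re_Im_coeff_bessel)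
        (use R in auto)
    then show "Im (coeff n r) = Im 0" by simp
  qed
  then have "f (polar 0 r \<theta>) = 0" if "r > R" for r \<theta>
    using that by (intro eq_if_coeff_eq[where K = "\<lambda>_. 0"]) (auto simp: fourier_coeff_def)
  moreover obtain r \<theta> where "r \<ge> 0" "x = polar 0 r \<theta>" by (rule polar_exists)
  ultimately show ?thesis using x dist_polar[of 0 r \<theta>] by auto
qed

end

lemma fourier_coeff_linear:
  assumes "continuous_on {0..2 * pi} u" "continuous_on {0..2 * pi} v"
  shows "fourier_coeff n (\<lambda>\<theta>. X * u \<theta> + Y * v \<theta>) = X * fourier_coeff n u + Y * fourier_coeff n v"
proof -
  have "fourier_coeff n (\<lambda>\<theta>. X * u \<theta> + Y * v \<theta>)
     = integral {0..2 * pi} (\<lambda>\<theta>. X * (u \<theta> * cis (- of_int n * \<theta>)) + Y * (v \<theta> * cis (- of_int n * \<theta>)))"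
    unfolding fourier_coeff_def by (simp add: algebra_simps)
  also have "\<dots> = integral {0..2 * pi} (\<lambda>\<theta>. X * (u \<theta> * cis (- of_int n * \<theta>)))
      + integral {0..2 * pi} (\<lambda>\<theta>. Y * (v \<theta> * cis (- of_int n * \<theta>)))"
    by (intro integral_add integrable_on_mult_right fourier_coeff_integrable assms)
  finally show ?thesis unfolding fourier_coeff_def integral_mult_right .
qed

section \<open>Local expansion in two complex variables\<close>

context planar_helmholtz
begin

text \<open>
  Near \<open>p\<close> the solution is the sum over \<open>k\<close> of \<open>(c\<^sub>k * w ^ k + d\<^sub>k * v ^ k) * bessel_part k (\<kappa>\<^sup>2 * w * v)\<close>
  with \<open>w\<close> and \<open>v\<close> equal to \<open>(x\<^sub>1 - p\<^sub>1) \<plusminus> \<i> (x\<^sub>2 - p\<^sub>2)\<close>; in this series \<open>w\<close> and \<open>v\<close> may be taken as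
  independent complex variables.
\<close>

lemma local_expansion:
  assumes \<kappa>: "\<kappa> > 0" and p: "p \<in> U"
  obtains \<rho> S where "\<rho> > 0"
    and "\<And>x. norm (x - p) \<le> \<rho> \<Longrightarrow>
      f x = S (Complex (x $ 1 - p $ 1) (x $ 2 - p $ 2)) (Complex (x $ 1 - p $ 1) (- (x $ 2 - p $ 2)))"
    and "\<And>A W V. \<lbrakk>open A; W holomorphic_on A; V holomorphic_on A;
      \<And>z. z \<in> A \<Longrightarrow> norm (W z) \<le> \<rho> \<and> norm (V z) \<le> \<rho>\<rbrakk> \<Longrightarrow> (\<lambda>z. S (W z) (V z)) holomorphic_on A"
proof -
  obtain R0 where R0: "R0 > 0" "ball p R0 \<subseteq> U"
    using open_U p by (auto elim: openE)
  \<comment> \<open>Radii below 1 / kappa keep the argument of the Bessel factor in the unit disc,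
    where it is close to 1.\<close>
  define R where "R = min R0 (1 / \<kappa>)"
  have R: "R > 0" "R \<le> R0" using R0 \<kappa> by (auto simp: R_def)
  have "\<kappa> * R \<le> \<kappa> * (1 / \<kappa>)" using \<kappa> by (intro mult_left_mono) (auto simp: R_def)
  then have \<kappa>R: "\<kappa> * R \<le> 1" using \<kappa> by simp
  interpret planar_helmholtz_polar \<kappa> U f g H p "{-R<..<R}"
  proof
    fix r \<theta> assume "r \<in> {-R<..<R}"
    then show "polar p r \<theta> \<in> U" using R0 R dist_polar[of p r \<theta>] by (intro subsetD[OF R0(2)]) auto
  qed auto
  have "\<exists>c. \<forall>r. 0 \<le> r \<and> r < R \<longrightarrow>
      coeff n r = c * of_real (r ^ nat \<bar>n\<bar> * bessel_part (nat \<bar>n\<bar>) ((\<kappa> * r)\<^sup>2))" for n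
  proof -
    have m: "(of_int n)\<^sup>2 = (real (nat \<bar>n\<bar>))\<^sup>2" by simp
    \<comment> \<open>Radius 0 is an interior point of the interval, so the coefficients are
      differentiable there; this singles out the regular Bessel solution.\<close>
    have "isCont (coeff' n) 0"
      using coeff'_deriv[of 0 n] R by (auto intro: has_vector_derivative_continuous)
    then have cont: "isCont (\<lambda>r. Re (coeff' n r)) 0" "isCont (\<lambda>r. Im (coeff' n r)) 0"
      by (auto intro: continuous_intros)
    obtain a where a: "\<forall>r. 0 \<le> r \<and> r < R \<longrightarrow> Re (coeff n r) = a * (r ^ nat \<bar>n\<bar> * bessel_part (nat \<bar>n\<bar>) ((\<kappa> * r)\<^sup>2))"
      using bessel_regular_solution[OF \<kappa> R(1) \<kappa>R Re_Im_coeff_deriv(1) Re_Im_coeff_bessel(1)[OF _ _ m] cont(1)] by force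
    obtain b where b: "\<forall>r. 0 \<le> r \<and> r < R \<longrightarrow> Im (coeff n r) = b * (r ^ nat \<bar>n\<bar> * bessel_part (nat \<bar>n\<bar>) ((\<kappa> * r)\<^sup>2))"
      using bessel_regular_solution[OF \<kappa> R(1) \<kappa>R Re_Im_coeff_deriv(2) Re_Im_coeff_bessel(2)[OF _ _ m] cont(2)] by force
    show ?thesis using a b by (intro exI[of _ "Complex a b"]) (simp add: complex_eq_iff)
  qed
  then obtain c where c: "\<And>n r. 0 \<le> r \<Longrightarrow> r < R \<Longrightarrow>
      coeff n r = c n * of_real (r ^ nat \<bar>n\<bar> * bessel_part (nat \<bar>n\<bar>) ((\<kappa> * r)\<^sup>2))" by metis
  \<comment> \<open>As with Cauchy estimates, the coefficients are bounded on the circle of radius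
    \<open>\<rho>\<^sub>0\<close> and the series is used for norms up to \<open>\<rho>\<close>; the
    ratio 1/2 of the radii gives a geometric majorant.\<close>
  define \<rho>\<^sub>0 where "\<rho>\<^sub>0 = R / 2"
  define \<rho> where "\<rho> = R / 4"
  have \<rho>: "0 < \<rho>" "0 < \<rho>\<^sub>0" "\<rho>\<^sub>0 < R" "\<rho> < R" using R by (auto simp: \<rho>_def \<rho>\<^sub>0_def)
  have sq_le: "(\<kappa> * r)\<^sup>2 \<le> 1" if "0 \<le> r" "r < R" for r
  proof -
    have "\<kappa> * r \<le> \<kappa> * R" using that \<kappa> by simp
    then have "\<kappa> * r \<le> 1" using \<kappa>R by linarith
    then show ?thesis using that \<kappa> by (simp add: power_le_one)
  qed
  have "continuous_on (cball p \<rho>\<^sub>0) f"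
    using R0 R \<rho> by (intro continuous_on_subset[OF f_cont]) auto
  from compact_imp_bounded[OF compact_continuous_image[OF this compact_cball]]
  obtain M where M: "M > 0" "\<And>x. x \<in> cball p \<rho>\<^sub>0 \<Longrightarrow> norm (f x) \<le> M"
    unfolding bounded_pos by (metis imageI)
  \<comment> \<open>The coefficient on the circle is at most 2 pi M, and the Bessel factor there is
    at least 2/3; the quotient is 3 pi M.\<close>
  have c_le: "norm (c n) \<le> 3 * pi * M / \<rho>\<^sub>0 ^ nat \<bar>n\<bar>" for n
  proof -
    define m where "m = nat \<bar>n\<bar>"
    define B where "B = bessel_part m ((\<kappa> * \<rho>\<^sub>0)\<^sup>2)"
    have "\<bar>B - 1\<bar> \<le> 1 / 3"
      using norm_bessel_part_diff_one[of "(\<kappa> * \<rho>\<^sub>0)\<^sup>2" m] sq_le[of \<rho>\<^sub>0] \<rho> by (simp add: B_def)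
    then have B: "B \<ge> 2 / 3" by linarith
    have "norm (coeff n \<rho>\<^sub>0) \<le> 2 * pi * M"
      unfolding coeff_def using \<rho> M(2) dist_polar[of p \<rho>\<^sub>0]
      by (intro norm_fourier_coeff_le f_polar_cont) auto
    moreover have "coeff n \<rho>\<^sub>0 = c n * of_real (\<rho>\<^sub>0 ^ m * B)"
      using c[of \<rho>\<^sub>0 n] \<rho> by (simp add: m_def B_def)
    ultimately have "norm (c n) * (\<rho>\<^sub>0 ^ m * B) \<le> 2 * pi * M"
      using B \<rho> by (simp add: norm_mult norm_power)
    moreover have "norm (c n) * (\<rho>\<^sub>0 ^ m * (2 / 3)) \<le> norm (c n) * (\<rho>\<^sub>0 ^ m * B)"
      using B \<rho> by (intro mult_left_mono) auto
    ultimately have "norm (c n) * \<rho>\<^sub>0 ^ m \<le> 3 * pi * M" by simp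
    then show ?thesis using \<rho> by (simp add: m_def[symmetric] field_simps)
  qed
  \<comment> \<open>Frequencies k and - k are collected in one term. For k = 0 they coincide, and
    the value 0 prevents counting that frequency twice.\<close>
  define d where "d = (\<lambda>k::nat. if k = 0 then 0 else c (- int k))"
  have d_le: "norm (d k) \<le> 3 * pi * M / \<rho>\<^sub>0 ^ k" for k
    using c_le[of "- int k"] M \<rho> by (auto simp: d_def)
  \<comment> \<open>At real points w * v is the squared distance to p, so the Bessel factor is the
    one found for the coefficients. The division makes up for \<open>fourier_coeff\<close> being an
    integral without normalisation.\<close>
  define T where "T = (\<lambda>k w v. (c (int k) * w ^ k + d k * v ^ k) * bessel_part k (of_real (\<kappa>\<^sup>2) * (w * v)) / of_real (2 * pi))"
  define S where "S = (\<lambda>w v. \<Sum>k. T k w v)"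
  \<comment> \<open>The factor 4 M is 6 pi M (two coefficients) times 4/3 (Bessel factor) divided by
    2 pi.\<close>
  define Mk where "Mk = (\<lambda>k::nat. 4 * M * (1 / 2) ^ k)"
  have Mk: "summable Mk" unfolding Mk_def by (intro summable_mult summable_geometric) simp
  have T_le: "norm (T k w v) \<le> Mk k" if w: "norm w \<le> \<rho>" and v: "norm v \<le> \<rho>" for k w v
  proof -
    have pw: "norm (a * u ^ k) \<le> 3 * pi * M * (1 / 2) ^ k"
      if "norm a \<le> 3 * pi * M / \<rho>\<^sub>0 ^ k" "norm u \<le> \<rho>" for a u :: complex
    proof -
      have "norm (a * u ^ k) \<le> 3 * pi * M / \<rho>\<^sub>0 ^ k * \<rho> ^ k"
        unfolding norm_mult norm_power using that \<rho> M by (intro mult_mono power_mono) auto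
      also have "\<dots> = 3 * pi * M * (\<rho> / \<rho>\<^sub>0) ^ k" by (simp add: power_divide)
      also have "\<rho> / \<rho>\<^sub>0 = 1 / 2" using R by (simp add: \<rho>_def \<rho>\<^sub>0_def)
      finally show ?thesis .
    qed
    have "norm (c (int k) * w ^ k + d k * v ^ k) \<le> 3 * pi * M * (1 / 2) ^ k + 3 * pi * M * (1 / 2) ^ k"
      using c_le[of "int k"] d_le[of k] w v by (intro norm_triangle_mono pw) auto
    then have 1: "norm (c (int k) * w ^ k + d k * v ^ k) \<le> 6 * pi * M * (1 / 2) ^ k" by (simp add: mult_ac)
    have "norm (of_real (\<kappa>\<^sup>2) * (w * v)) = \<kappa>\<^sup>2 * (norm w * norm v)"
      by (simp add: norm_mult norm_power)
    also have "\<dots> \<le> \<kappa>\<^sup>2 * (\<rho> * \<rho>)" using w v \<rho> by (intro mult_left_mono mult_mono) auto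
    also have "\<dots> = (\<kappa> * \<rho>)\<^sup>2" by (simp add: power2_eq_square)
    also have "\<dots> \<le> 1" using \<rho> by (intro sq_le) auto
    finally have "norm (bessel_part k (of_real (\<kappa>\<^sup>2) * (w * v)) - 1) \<le> 1 / 3"
      by (rule norm_bessel_part_diff_one)
    then have 2: "norm (bessel_part k (of_real (\<kappa>\<^sup>2) * (w * v))) \<le> 4 / 3"
      using norm_triangle_sub[of "bessel_part k (of_real (\<kappa>\<^sup>2) * (w * v))" 1] by simp
    have "norm (T k w v) \<le> (6 * pi * M * (1 / 2) ^ k) * (4 / 3) / (2 * pi)"
      unfolding T_def norm_divide norm_mult[of "_ + _"] using 1 2 M
      by (intro frac_le mult_mono) auto
    then show ?thesis by (simp add: Mk_def)
  qed
  have bessel_hol: "bessel_part k holomorphic_on UNIV" for k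
    using bessel_part_ode[of k, where 'a = complex]
    by (metis field_differentiable_def field_differentiable_at_within holomorphic_on_def)
  have T_hol: "(\<lambda>z. T k (W z) (V z)) holomorphic_on A" if "W holomorphic_on A" "V holomorphic_on A" for k W V A
    unfolding T_def
    by (intro holomorphic_intros that holomorphic_on_compose_gen[OF _ bessel_hol, unfolded o_def]) auto
  show ?thesis
  proof (rule that[of \<rho> S])
    show "\<rho> > 0" by fact
  next
    fix A W V assume A: "open A" and W: "W holomorphic_on A" and V: "V holomorphic_on A"
      and le: "\<And>z. z \<in> A \<Longrightarrow> norm (W z) \<le> \<rho> \<and> norm (V z) \<le> \<rho>"
    have ul: "uniform_limit A (\<lambda>N z. \<Sum>k<N. T k (W z) (V z)) (\<lambda>z. S (W z) (V z)) sequentially"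
      unfolding S_def using le by (intro Weierstrass_m_test[OF _ Mk] T_le) auto
    show "(\<lambda>z. S (W z) (V z)) holomorphic_on A"
    proof (rule holomorphic_uniform_sequence[OF A])
      show "(\<lambda>z. \<Sum>k<N. T k (W z) (V z)) holomorphic_on A" for N
        by (intro holomorphic_on_sum T_hol W V)
      fix z assume "z \<in> A"
      then obtain e where "e > 0" "cball z e \<subseteq> A" using A open_contains_cball by blast
      then show "\<exists>e>0. cball z e \<subseteq> A \<and> uniform_limit (cball z e) (\<lambda>N z. \<Sum>k<N. T k (W z) (V z)) (\<lambda>z. S (W z) (V z)) sequentially"
        using uniform_limit_on_subset[OF ul] by blast
    qed
  next
    fix x assume x: "norm (x - p) \<le> \<rho>"
    obtain r \<theta> where r: "r \<ge> 0" and x_polar: "x = polar p r \<theta>" by (rule polar_exists)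
    have "r \<le> \<rho>" using x dist_polar[of p r \<theta>] r by (simp add: x_polar dist_norm norm_minus_commute)
    define h where "h = (\<lambda>k z. T k (of_real r * z) (of_real r * cnj z))"
    have h_cont: "continuous_on (sphere 0 1) (h k)" for k
    proof -
      have "continuous_on UNIV (bessel_part k :: complex \<Rightarrow> complex)"
        using bessel_hol by (rule holomorphic_on_imp_continuous_on)
      then show ?thesis unfolding h_def T_def
        by (intro continuous_intros continuous_on_compose2[where f = "\<lambda>z. of_real (\<kappa>\<^sup>2) * (of_real r * z * (of_real r * cnj z))"]) auto
    qed
    have h_le: "norm (h k z) \<le> Mk k" if "z \<in> sphere 0 1" for k z
      unfolding h_def using that r \<open>r \<le> \<rho>\<close> by (intro T_le) (auto simp: norm_mult)
    \<comment> \<open>On the circle the k-th term contains only the frequencies k and - k, so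
      exactly one term of the series contributes to the n-th coefficient.\<close>
    have h_coeff: "fourier_coeff n (\<lambda>\<theta>. h k (cis \<theta>)) = (if k = nat \<bar>n\<bar> then coeff n r else 0)" for n k
    proof -
      define B where "B = complex_of_real (r ^ k * bessel_part k ((\<kappa> * r)\<^sup>2)) / of_real (2 * pi)"
      have "h k (cis \<theta>) = (c (int k) * B) * cis (of_int (int k) * \<theta>) + (d k * B) * cis (of_int (- int k) * \<theta>)" for \<theta>
      proof -
        have "cis \<theta> * cnj (cis \<theta>) = 1" by (simp add: cis_cnj cis_mult)
        then have "of_real (\<kappa>\<^sup>2) * (of_real r * cis \<theta> * (of_real r * cnj (cis \<theta>))) = complex_of_real ((\<kappa> * r)\<^sup>2)"
          by (simp add: power2_eq_square mult_ac)
        then have "bessel_part k (of_real (\<kappa>\<^sup>2) * (of_real r * cis \<theta> * (of_real r * cnj (cis \<theta>))))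
            = complex_of_real (bessel_part k ((\<kappa> * r)\<^sup>2))" by (simp only: of_real_bessel_part)
        moreover have "(of_real r * cis \<theta>) ^ k = of_real (r ^ k) * cis (of_int (int k) * \<theta>)"
          "(of_real r * cnj (cis \<theta>)) ^ k = of_real (r ^ k) * cis (of_int (- int k) * \<theta>)"
          by (simp_all add: power_mult_distrib Complex.DeMoivre cis_cnj)
        ultimately show ?thesis
          unfolding h_def T_def B_def
          by (simp only:) (simp add: algebra_simps add_divide_distrib)
      qed
      then have "fourier_coeff n (\<lambda>\<theta>. h k (cis \<theta>)) = (c (int k) * B) * fourier_coeff n (\<lambda>\<theta>. cis (of_int (int k) * \<theta>))
          + (d k * B) * fourier_coeff n (\<lambda>\<theta>. cis (of_int (- int k) * \<theta>))"
        by (simp only: fourier_coeff_linear continuous_on_cis_mult)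
      also have "\<dots> = (if k = nat \<bar>n\<bar> then c n * (B * of_real (2 * pi)) else 0)"
        unfolding fourier_coeff_cis d_def by auto
      also have "B * of_real (2 * pi) = of_real (r ^ k * bessel_part k ((\<kappa> * r)\<^sup>2))"
        by (simp add: B_def)
      finally show ?thesis using c[of r n] r \<open>r \<le> \<rho>\<close> \<rho> by auto
    qed
    have "f (polar p r \<theta>) = (\<lambda>z. \<Sum>k. h k z) (cis \<theta>)"
    proof (rule eq_if_coeff_eq)
      show "r \<in> {-R<..<R}" using r \<open>r \<le> \<rho>\<close> \<rho> by auto
      show "continuous_on (sphere 0 1) (\<lambda>z. \<Sum>k. h k z)"
        by (rule fourier_coeff_suminf(1)[OF h_cont h_le Mk])
      show "fourier_coeff n (\<lambda>\<theta>. \<Sum>k. h k (cis \<theta>)) = coeff n r" for n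
        using fourier_coeff_suminf(2)[OF h_cont h_le Mk, of n] sums_single[of "nat \<bar>n\<bar>" "\<lambda>_. coeff n r"]
        unfolding h_coeff by (rule sums_unique2)
    qed
    also have "\<dots> = S (of_real r * cis \<theta>) (of_real r * cnj (cis \<theta>))" by (simp add: S_def h_def)
    also have "of_real r * cis \<theta> = Complex (x $ 1 - p $ 1) (x $ 2 - p $ 2)"
      by (simp add: complex_eq_iff x_polar)
    also have "of_real r * cnj (cis \<theta>) = Complex (x $ 1 - p $ 1) (- (x $ 2 - p $ 2))"
      by (simp add: complex_eq_iff x_polar)
    finally show "f x = S (Complex (x $ 1 - p $ 1) (x $ 2 - p $ 2)) (Complex (x $ 1 - p $ 1) (- (x $ 2 - p $ 2)))"
      by (simp only: x_polar)
  qed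
qed

end

section \<open>Analytic continuation\<close>

text \<open>The topological half of every identity theorem below. It is stated in the subspace
  topology so that the same argument serves intervals of parameters, the domain \<open>U\<close> and
  the boundary curve.\<close>

lemma connected_zero_propagation:
  assumes "connected S" and W: "openin (top_of_set S) W" "W \<noteq> {}" "\<And>x. x \<in> W \<Longrightarrow> h x = (0::'b::zero)"
    and step: "\<And>a. a \<in> S \<Longrightarrow> \<exists>T. openin (top_of_set S) T \<and> a \<in> T \<and>
      (\<forall>W. openin (top_of_set S) W \<and> W \<subseteq> T \<and> W \<noteq> {} \<and> (\<forall>x\<in>W. h x = 0) \<longrightarrow> (\<forall>x\<in>T. h x = 0))"
    and b: "b \<in> S"
  shows "h b = 0"
proof -
  \<comment> \<open>Vanishing near the point: an isolated zero would not propagate.\<close>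
  define P where "P = (\<lambda>x. \<exists>T. openin (top_of_set S) T \<and> x \<in> T \<and> (\<forall>y\<in>T. h y = 0))"
  obtain a where a: "a \<in> W" using W by blast
  have "P b"
  proof (rule connected_induction_simple[OF \<open>connected S\<close>])
    show "a \<in> S" using a W(1) openin_imp_subset by blast
    show "P a" using a W by (auto simp: P_def)
    fix x assume "x \<in> S"
    from step[OF this] obtain T where T: "openin (top_of_set S) T" "x \<in> T"
      and T_zero: "\<forall>W. openin (top_of_set S) W \<and> W \<subseteq> T \<and> W \<noteq> {} \<and> (\<forall>x\<in>W. h x = 0) \<longrightarrow> (\<forall>x\<in>T. h x = 0)"
      by (elim exE conjE)
    have "P z" if yz: "y \<in> T" "z \<in> T" and "P y" for y z
    proof -
      obtain T' where T': "openin (top_of_set S) T'" "y \<in> T'" "\<forall>y\<in>T'. h y = 0"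
        using \<open>P y\<close> unfolding P_def by blast
      \<comment> \<open>Both sets are neighbourhoods of y, so their intersection is a nonempty open
        set of zeros inside \<open>T\<close>.\<close>
      have "\<forall>x\<in>T. h x = 0"
        by (rule mp[OF spec[OF T_zero, of "T \<inter> T'"]]) (use T T' yz in auto)
      then show ?thesis using T yz unfolding P_def by (intro exI[of _ T]) simp
    qed
    then show "\<exists>T. openin (top_of_set S) T \<and> x \<in> T \<and> (\<forall>x\<in>T. \<forall>y\<in>T. P x \<longrightarrow> P y)"
      using T by (intro exI[of _ T]) blast
  qed (rule b)
  then show ?thesis unfolding P_def by blast
qed

text \<open>Real analyticity in the form in which the local expansion delivers it: a holomorphic
  function on a disc, to which the complex identity theorem applies directly.\<close>

definition extends_holomorphically :: "(real \<Rightarrow> complex) \<Rightarrow> real \<Rightarrow> bool" where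
  "extends_holomorphically h s \<longleftrightarrow>
    (\<exists>F. \<exists>r>0. F holomorphic_on ball (of_real s) r \<and> (\<forall>t. \<bar>t - s\<bar> < r \<longrightarrow> h t = F (of_real t)))"

text \<open>Locally, a real interval of zeros has limit points inside the complex disc, which forces
  the holomorphic extension to vanish.\<close>

lemma extends_holomorphically_identity:
  assumes S: "open S" "connected S" and h: "\<And>s. s \<in> S \<Longrightarrow> extends_holomorphically h s"
    and W: "open W" "W \<noteq> {}" "W \<subseteq> S" "\<And>t. t \<in> W \<Longrightarrow> h t = 0" and s: "s \<in> S"
  shows "h s = 0"
proof (rule connected_zero_propagation[OF S(2) _ W(2,4) _ s])
  show "openin (top_of_set S) W" using W S by (simp add: openin_open_eq)
  fix a assume a: "a \<in> S"
  obtain F r where r: "r > 0" and F: "F holomorphic_on ball (of_real a) r"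
    and hF: "\<And>t. \<bar>t - a\<bar> < r \<Longrightarrow> h t = F (of_real t)"
    using h[OF a] unfolding extends_holomorphically_def by blast
  obtain d where d: "d > 0" "ball a d \<subseteq> S" using S a by (auto elim: openE)
  define T where "T = ball a (min r d)"
  have "h x = 0" if W': "openin (top_of_set S) W'" "W' \<subseteq> T" "W' \<noteq> {}" "\<forall>x\<in>W'. h x = 0" and x: "x \<in> T" for W' x
  proof -
    obtain t where t: "t \<in> W'" using W' by blast
    have "open W'" using W'(1) S(1) openin_open_eq by blast
    then obtain e where e: "e > 0" "ball t e \<subseteq> W'" using t by (auto elim: openE)
    have near: "\<bar>u - a\<bar> < r" if "u \<in> T" for u
      using that by (auto simp: T_def dist_real_def abs_minus_commute)
    have in_ball: "complex_of_real u \<in> ball (of_real a) r" if "u \<in> T" for u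
      using near[OF that] by (simp add: dist_norm abs_minus_commute flip: of_real_diff)
    have "F (of_real x) = 0"
    proof (rule analytic_continuation[OF F, of "of_real ` ball t e" "of_real t"])
      show "of_real ` ball t e \<subseteq> ball (complex_of_real a) r"
        using in_ball e W'(2) by blast
      show "complex_of_real t \<in> ball (of_real a) r" using in_ball t W'(2) by blast
      show "complex_of_real t islimpt of_real ` ball t e"
        unfolding islimpt_approachable
      proof (intro allI impI)
        fix \<epsilon> :: real assume "\<epsilon> > 0"
        define u where "u = t + min e \<epsilon> / 2"
        have u: "0 < min e \<epsilon> / 2" "min e \<epsilon> / 2 < e" "min e \<epsilon> / 2 < \<epsilon>"
          using e \<open>\<epsilon> > 0\<close> by auto
        then have "u \<in> ball t e" "u \<noteq> t" "dist (complex_of_real u) (of_real t) < \<epsilon>"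
          by (simp_all add: u_def dist_norm del: of_real_add flip: of_real_diff)
        then show "\<exists>z\<in>of_real ` ball t e. z \<noteq> complex_of_real t \<and> dist z (of_real t) < \<epsilon>"
          by (intro bexI[of _ "of_real u"]) auto
      qed
      show "F z = 0" if z: "z \<in> of_real ` ball t e" for z
      proof -
        obtain u where u: "z = of_real u" "u \<in> ball t e" using z by blast
        then have "u \<in> W'" using e by blast
        then show ?thesis using W'(2,4) hF[OF near[of u]] u by auto
      qed
      show "complex_of_real x \<in> ball (of_real a) r" using in_ball x by blast
    qed auto
    then show ?thesis using hF[OF near[OF x]] by simp
  qed
  moreover have "openin (top_of_set S) T" "a \<in> T"
    using S d r by (auto simp: T_def openin_open_eq)
  ultimately show "\<exists>T. openin (top_of_set S) T \<and> a \<in> T \<and>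
      (\<forall>W. openin (top_of_set S) W \<and> W \<subseteq> T \<and> W \<noteq> {} \<and> (\<forall>x\<in>W. h x = 0) \<longrightarrow> (\<forall>x\<in>T. h x = 0))"
    by blast
qed

text \<open>The real power series also converges in the complex disc of the same radius: a point w
  lies strictly inside the circle through some real point s + q at which convergence is
  known.\<close>

lemma real_analytic_at_nth:
  fixes \<gamma> :: "real \<Rightarrow> real^'n"
  assumes "real_analytic_at \<gamma> s"
  shows "extends_holomorphically (\<lambda>t. of_real (\<gamma> t $ i)) s"
proof -
  obtain a r where r: "r > 0" and a: "\<And>t. \<bar>t - s\<bar> < r \<Longrightarrow> (\<lambda>n. (t - s) ^ n *\<^sub>R a n) sums \<gamma> t"
    using assms unfolding real_analytic_at_def by blast
  have sums: "(\<lambda>n. complex_of_real (a n $ i) * (of_real t - of_real s) ^ n) sums of_real (\<gamma> t $ i)" if "\<bar>t - s\<bar> < r" for t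
  proof -
    have "(\<lambda>n. ((t - s) ^ n *\<^sub>R a n) $ i) sums (\<gamma> t $ i)"
      by (rule bounded_linear.sums[OF bounded_linear_vec_nth a[OF that]])
    then have "(\<lambda>n. complex_of_real ((t - s) ^ n * a n $ i)) sums of_real (\<gamma> t $ i)"
      by (subst sums_of_real_iff) simp
    then show ?thesis by (simp add: mult.commute)
  qed
  define F where "F = (\<lambda>z. \<Sum>n. complex_of_real (a n $ i) * (z - of_real s) ^ n)"
  have "(\<lambda>n. complex_of_real (a n $ i) * (w - of_real s) ^ n) sums F w" if w: "w \<in> ball (of_real s) r" for w
  proof -
    obtain q where q: "norm (w - of_real s) < q" "q < r"
      using w dense by (metis dist_commute dist_norm mem_ball)
    then have "q > 0" by (meson norm_ge_zero order_le_less_trans)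
    have "summable (\<lambda>n. complex_of_real (a n $ i) * (of_real q) ^ n)"
      using sums[of "s + q"] q \<open>q > 0\<close> by (auto dest: sums_summable)
    then have "summable (\<lambda>n. complex_of_real (a n $ i) * (w - of_real s) ^ n)"
      by (rule powser_inside) (use q \<open>q > 0\<close> in simp)
    then show ?thesis unfolding F_def by (rule summable_sums)
  qed
  then have "F holomorphic_on ball (of_real s) r" by (rule power_series_holomorphic)
  moreover have "complex_of_real (\<gamma> t $ i) = F (of_real t)" if "\<bar>t - s\<bar> < r" for t
    using sums[OF that] unfolding F_def by (rule sums_unique)
  ultimately show ?thesis using r unfolding extends_holomorphically_def by blast
qed

lemma real_analytic_at_line: "real_analytic_at (\<lambda>t. q + t *\<^sub>R v) s"
proof -
  define a where "a = (\<lambda>n::nat. if n = 0 then q + s *\<^sub>R v else if n = 1 then v else 0)"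
  have "(\<lambda>n. (t - s) ^ n *\<^sub>R a n) sums (q + t *\<^sub>R v)" for t
  proof -
    have "(\<lambda>n. (t - s) ^ n *\<^sub>R a n) sums (\<Sum>n\<in>{0, 1}. (t - s) ^ n *\<^sub>R a n)"
      by (rule sums_finite) (auto simp: a_def)
    also have "(\<Sum>n\<in>{0, 1}. (t - s) ^ n *\<^sub>R a n) = q + t *\<^sub>R v"
      by (simp add: a_def algebra_simps)
    finally show ?thesis .
  qed
  then show ?thesis unfolding real_analytic_at_def using zero_less_one by blast
qed

section \<open>Continuation of solutions along curves and in the plane\<close>

context planar_helmholtz
begin

text \<open>The coordinates of the curve extend to holomorphic \<open>F1\<close> and
  \<open>F2\<close>, which are substituted into the local expansion. Off the real axis the resulting
  \<open>W\<close> and \<open>V\<close> are in general not conjugate to each other; hence the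
  independence of the two variables in the expansion.\<close>

lemma extends_along_curve:
  assumes \<kappa>: "\<kappa> > 0" and \<gamma>: "real_analytic_at \<gamma> s" and U: "\<gamma> s \<in> U"
  shows "extends_holomorphically (\<lambda>t. f (\<gamma> t)) s"
proof -
  define p where "p = \<gamma> s"
  obtain \<rho> S where \<rho>: "\<rho> > 0"
    and fS: "\<And>x. norm (x - p) \<le> \<rho> \<Longrightarrow>
      f x = S (Complex (x $ 1 - p $ 1) (x $ 2 - p $ 2)) (Complex (x $ 1 - p $ 1) (- (x $ 2 - p $ 2)))"
    and S: "\<And>A W V. \<lbrakk>open A; W holomorphic_on A; V holomorphic_on A;
      \<And>z. z \<in> A \<Longrightarrow> norm (W z) \<le> \<rho> \<and> norm (V z) \<le> \<rho>\<rbrakk> \<Longrightarrow> (\<lambda>z. S (W z) (V z)) holomorphic_on A"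
    by (rule local_expansion[OF \<kappa> U[folded p_def]]) iprover
  obtain F1 r1 where F1: "r1 > 0" "F1 holomorphic_on ball (of_real s) r1"
    "\<And>t. \<bar>t - s\<bar> < r1 \<Longrightarrow> of_real (\<gamma> t $ 1) = F1 (of_real t)"
    using real_analytic_at_nth[OF \<gamma>, of 1] unfolding extends_holomorphically_def by blast
  obtain F2 r2 where F2: "r2 > 0" "F2 holomorphic_on ball (of_real s) r2"
    "\<And>t. \<bar>t - s\<bar> < r2 \<Longrightarrow> of_real (\<gamma> t $ 2) = F2 (of_real t)"
    using real_analytic_at_nth[OF \<gamma>, of 2] unfolding extends_holomorphically_def by blast
  define B where "B = ball (complex_of_real s) (min r1 r2)"
  define W where "W = (\<lambda>z. (F1 z - of_real (p $ 1)) + \<i> * (F2 z - of_real (p $ 2)))"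
  define V where "V = (\<lambda>z. (F1 z - of_real (p $ 1)) - \<i> * (F2 z - of_real (p $ 2)))"
  have "F1 holomorphic_on B" "F2 holomorphic_on B"
    by (rule holomorphic_on_subset[OF F1(2)] holomorphic_on_subset[OF F2(2)]; simp add: B_def subset_ball)+
  then have hol: "W holomorphic_on B" "V holomorphic_on B"
    unfolding W_def V_def by (auto intro!: holomorphic_intros)
  have B: "open B" "of_real s \<in> B" using F1 F2 by (auto simp: B_def)
  have real: "W (of_real t) = Complex (\<gamma> t $ 1 - p $ 1) (\<gamma> t $ 2 - p $ 2)"
    "V (of_real t) = Complex (\<gamma> t $ 1 - p $ 1) (- (\<gamma> t $ 2 - p $ 2))"
    if "\<bar>t - s\<bar> < r1" "\<bar>t - s\<bar> < r2" for t
    unfolding W_def V_def F1(3)[OF that(1), symmetric] F2(3)[OF that(2), symmetric]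
    by (simp_all add: complex_eq_iff)
  \<comment> \<open>The expansion is centred at the point of the curve itself, so by continuity both
    arguments stay below \<open>\<rho>\<close> on a small disc.\<close>
  have "W (of_real s) = 0" "V (of_real s) = 0" using real[of s] F1 F2 by (simp_all add: p_def complex_eq_iff)
  moreover have "isCont W (of_real s)" "isCont V (of_real s)"
    using hol B by (auto dest!: holomorphic_on_imp_continuous_on simp: continuous_on_eq_continuous_at)
  ultimately have "(W \<longlongrightarrow> 0) (nhds (of_real s))" "(V \<longlongrightarrow> 0) (nhds (of_real s))"
    using tendsto_at_iff_tendsto_nhds[of W "of_real s"] tendsto_at_iff_tendsto_nhds[of V "of_real s"]
    by (simp_all add: isCont_def)
  from this[THEN tendstoD, OF \<rho>] eventually_nhds_in_open[OF B]
  have "\<forall>\<^sub>F z in nhds (of_real s). norm (W z) < \<rho> \<and> norm (V z) < \<rho> \<and> z \<in> B"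
    by eventually_elim simp
  then obtain r where r: "r > 0" "\<And>z. dist z (of_real s) < r \<Longrightarrow> norm (W z) < \<rho> \<and> norm (V z) < \<rho> \<and> z \<in> B"
    unfolding eventually_nhds_metric by blast
  define A where "A = ball (complex_of_real s) r"
  have A: "norm (W z) < \<rho>" "norm (V z) < \<rho>" "z \<in> B" if "z \<in> A" for z
    using r(2)[of z] that by (auto simp: A_def dist_commute)
  have "(\<lambda>z. S (W z) (V z)) holomorphic_on A"
  proof (rule S)
    show "W holomorphic_on A" "V holomorphic_on A"
      using A(3) by (auto intro: holomorphic_on_subset[OF hol(1)] holomorphic_on_subset[OF hol(2)])
  qed (use A in \<open>auto simp: A_def less_imp_le\<close>)
  moreover have "f (\<gamma> t) = S (W (of_real t)) (V (of_real t))" if "\<bar>t - s\<bar> < r" for t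
  proof -
    have tA: "complex_of_real t \<in> A"
      using that by (simp add: A_def dist_norm abs_minus_commute flip: of_real_diff)
    have "\<bar>t - s\<bar> < min r1 r2"
      using A(3)[OF tA] by (simp add: B_def dist_norm abs_minus_commute flip: of_real_diff)
    then have eqs: "W (of_real t) = Complex (\<gamma> t $ 1 - p $ 1) (\<gamma> t $ 2 - p $ 2)"
      "V (of_real t) = Complex (\<gamma> t $ 1 - p $ 1) (- (\<gamma> t $ 2 - p $ 2))"
      using real by auto
    have "norm (\<gamma> t - p) = norm (W (of_real t))"
      unfolding eqs norm_vec_2 by (simp add: cmod_def)
    then have "norm (\<gamma> t - p) \<le> \<rho>" using A(1)[OF tA] by simp
    from fS[OF this] show ?thesis unfolding eqs .
  qed
  ultimately show ?thesis
    using r(1) unfolding extends_holomorphically_def A_def by blast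
qed

text \<open>Inside a ball, a target point is joined by a line to a point near which f vanishes.
  Along the line only the one-variable identity theorem is needed.\<close>

lemma unique_continuation:
  assumes \<kappa>: "\<kappa> > 0" and U: "connected U"
    and W: "open W" "W \<noteq> {}" "W \<subseteq> U" "\<And>x. x \<in> W \<Longrightarrow> f x = 0" and x: "x \<in> U"
  shows "f x = 0"
proof (rule connected_zero_propagation[OF U _ W(2,4) _ x])
  show "openin (top_of_set U) W" using W open_U by (simp add: openin_open_eq)
  fix a assume "a \<in> U"
  then obtain r where r: "r > 0" "ball a r \<subseteq> U" using open_U by (auto elim: openE)
  have "f y = 0" if W': "openin (top_of_set U) W'" "W' \<subseteq> ball a r" "W' \<noteq> {}" "\<forall>x\<in>W'. f x = 0"
    and y: "y \<in> ball a r" for W' y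
  proof -
    obtain q where q: "q \<in> W'" using W' by blast
    define \<gamma> where "\<gamma> = (\<lambda>t. q + t *\<^sub>R (y - q))"
    have cont: "continuous_on UNIV \<gamma>" unfolding \<gamma>_def by (intro continuous_intros)
    have "open W'" using W'(1) open_U openin_open_eq by blast
    \<comment> \<open>The parameters for which the line stays in the ball: an open interval that
      contains 0 and 1.\<close>
    define J where "J = \<gamma> -` ball a r"
    have J: "open J" unfolding J_def using cont by (intro open_vimage) auto
    have "convex J"
      unfolding convex_alt
    proof (intro ballI allI impI)
      fix s t u assume st: "s \<in> J" "t \<in> J" and u: "0 \<le> u \<and> u \<le> (1::real)"
      have "\<gamma> ((1 - u) *\<^sub>R s + u *\<^sub>R t) = (1 - u) *\<^sub>R \<gamma> s + u *\<^sub>R \<gamma> t"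
        by (simp add: \<gamma>_def algebra_simps)
      also have "\<dots> \<in> ball a r"
        using convex_ball[of a r] st u unfolding convex_alt J_def by blast
      finally show "(1 - u) *\<^sub>R s + u *\<^sub>R t \<in> J" by (simp add: J_def)
    qed
    have "f (\<gamma> 1) = 0"
    proof (rule extends_holomorphically_identity[of J "\<lambda>t. f (\<gamma> t)" "\<gamma> -` W'"])
      show "connected J" using \<open>convex J\<close> by (rule convex_connected)
      show "extends_holomorphically (\<lambda>t. f (\<gamma> t)) s" if "s \<in> J" for s
        using that r unfolding \<gamma>_def by (intro extends_along_curve[OF \<kappa> real_analytic_at_line]) (auto simp: J_def \<gamma>_def)
      show "open (\<gamma> -` W')" using cont \<open>open W'\<close> by (intro open_vimage) auto
      have "\<gamma> 0 \<in> W'" using q by (simp add: \<gamma>_def)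
      then show "\<gamma> -` W' \<noteq> {}" by blast
      show "\<gamma> -` W' \<subseteq> J" using W'(2) by (auto simp: J_def)
      show "1 \<in> J" using y by (simp add: J_def \<gamma>_def)
    qed (use J W' in auto)
    then show ?thesis by (simp add: \<gamma>_def)
  qed
  moreover have "openin (top_of_set U) (ball a r)" "a \<in> ball a r"
    using r open_U by (auto simp: openin_open_eq)
  ultimately show "\<exists>T. openin (top_of_set U) T \<and> a \<in> T \<and>
      (\<forall>W. openin (top_of_set U) W \<and> W \<subseteq> T \<and> W \<noteq> {} \<and> (\<forall>x\<in>W. f x = 0) \<longrightarrow> (\<forall>x\<in>T. f x = 0))"
    by blast
qed

text \<open>A chart pulls a relatively open piece of the curve back to an open set of parameters,
  where the one-variable identity theorem applies; connectedness of the curve links the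
  charts.\<close>

lemma zero_on_analytic_curve:
  assumes \<kappa>: "\<kappa> > 0" and \<Gamma>: "real_analytic_curve \<Gamma>" "connected \<Gamma>" "\<Gamma> \<subseteq> U"
    and \<Lambda>: "openin (top_of_set \<Gamma>) \<Lambda>" "\<Lambda> \<noteq> {}" "\<And>x. x \<in> \<Lambda> \<Longrightarrow> f x = 0" and x: "x \<in> \<Gamma>"
  shows "f x = 0"
proof (rule connected_zero_propagation[OF \<Gamma>(2) \<Lambda> _ x])
  fix a assume "a \<in> \<Gamma>"
  then obtain V \<gamma> g' where V: "open V" "a \<in> V" and hom: "homeomorphism {-1<..<1} (\<Gamma> \<inter> V) \<gamma> g'"
    and an: "\<And>t. t \<in> {-1<..<1} \<Longrightarrow> real_analytic_at \<gamma> t"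
    using \<Gamma>(1) unfolding real_analytic_curve_def by metis
  have cont: "continuous_on {-1<..<1} \<gamma>" and img: "\<gamma> ` {-1<..<1} = \<Gamma> \<inter> V"
    using hom by (auto simp: homeomorphism_def)
  have "f y = 0" if W: "openin (top_of_set \<Gamma>) W" "W \<subseteq> \<Gamma> \<inter> V" "W \<noteq> {}" "\<forall>x\<in>W. f x = 0"
    and y: "y \<in> \<Gamma> \<inter> V" for W y
  proof -
    obtain O' where O': "open O'" "W = \<Gamma> \<inter> O'" using W(1) by (auto simp: openin_open)
    obtain s where s: "s \<in> {-1<..<1}" "y = \<gamma> s" using y img by blast
    have "f (\<gamma> s) = 0"
    proof (rule extends_holomorphically_identity[of "{-1<..<1}" "\<lambda>t. f (\<gamma> t)" "{-1<..<1} \<inter> \<gamma> -` O'"])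
      show "open ({-1<..<1} \<inter> \<gamma> -` O')"
        using cont O' by (intro continuous_open_preimage) auto
      show "extends_holomorphically (\<lambda>t. f (\<gamma> t)) t" if "t \<in> {-1<..<1}" for t
        using that img \<Gamma>(3) by (intro extends_along_curve[OF \<kappa> an]) auto
      show "{-1<..<1} \<inter> \<gamma> -` O' \<noteq> {}"
      proof -
        obtain w where "w \<in> W" using W by blast
        moreover then obtain t where "t \<in> {-1<..<1}" "w = \<gamma> t" using W(2) img by blast
        ultimately show ?thesis using O' by blast
      qed
      show "f (\<gamma> t) = 0" if "t \<in> {-1<..<1} \<inter> \<gamma> -` O'" for t
        using that img W(4) O' by blast
    qed (use s in auto)
    then show ?thesis using s by simp
  qed
  moreover have "openin (top_of_set \<Gamma>) (\<Gamma> \<inter> V)" "a \<in> \<Gamma> \<inter> V"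
    using V \<open>a \<in> \<Gamma>\<close> by auto
  ultimately show "\<exists>T. openin (top_of_set \<Gamma>) T \<and> a \<in> T \<and>
      (\<forall>W. openin (top_of_set \<Gamma>) W \<and> W \<subseteq> T \<and> W \<noteq> {} \<and> (\<forall>x\<in>W. f x = 0) \<longrightarrow> (\<forall>x\<in>T. f x = 0))"
    by blast
qed

end

section \<open>Radiation solutions\<close>

lemma vec_2_axis: "h = h $ 1 *\<^sub>R axis 1 1 + h $ 2 *\<^sub>R axis 2 (1::real)" for h :: "real^2"
  by (simp add: vec_eq_iff forall_2)

lemma has_derivative_partial_deriv:
  fixes f :: "real^2 \<Rightarrow> 'b::real_normed_vector"
  assumes "f differentiable at x"
  shows "(f has_derivative (\<lambda>h. h $ 1 *\<^sub>R partial_deriv 1 f x + h $ 2 *\<^sub>R partial_deriv 2 f x)) (at x)"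
proof -
  let ?D = "frechet_derivative f (at x)"
  have D: "(f has_derivative ?D) (at x)" using assms frechet_derivative_works by blast
  interpret bounded_linear ?D using D by (rule has_derivative_bounded_linear)
  have "?D h = h $ 1 *\<^sub>R partial_deriv 1 f x + h $ 2 *\<^sub>R partial_deriv 2 f x" for h
    unfolding partial_deriv_def by (subst vec_2_axis) (simp only: add scaleR)
  then have "?D = (\<lambda>h. h $ 1 *\<^sub>R partial_deriv 1 f x + h $ 2 *\<^sub>R partial_deriv 2 f x)" by blast
  with D show ?thesis by simp
qed

lemma partial_deriv_eq:
  fixes a :: "2 \<Rightarrow> 'b::real_normed_vector"
  assumes "(f has_derivative (\<lambda>h. h $ 1 *\<^sub>R a 1 + h $ 2 *\<^sub>R a 2)) (at x)"
  shows "partial_deriv i f x = a i"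
  using exhaust_2[of i] unfolding partial_deriv_def frechet_derivative_at[OF assms, symmetric] by auto

lemma planar_helmholtz_of_C2:
  assumes U: "open U" and C2: "C2_on U f"
    and eq: "\<And>x. x \<in> U \<Longrightarrow> laplacian f x + of_real (\<kappa>\<^sup>2) * f x = 0"
  shows "planar_helmholtz \<kappa> U f (\<lambda>i. partial_deriv i f) (\<lambda>i j. partial_deriv j (partial_deriv i f))"
proof
  show "(f has_derivative (\<lambda>h. h $ 1 *\<^sub>R partial_deriv 1 f x + h $ 2 *\<^sub>R partial_deriv 2 f x)) (at x)"
    if "x \<in> U" for x
    using that C2 U unfolding C2_on_def
    by (intro has_derivative_partial_deriv) (simp add: differentiable_on_eq_differentiable_at)
  show "(partial_deriv i f has_derivative (\<lambda>h. h $ 1 *\<^sub>R partial_deriv 1 (partial_deriv i f) x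
      + h $ 2 *\<^sub>R partial_deriv 2 (partial_deriv i f) x)) (at x)" if "x \<in> U" for x i
    using that C2 U unfolding C2_on_def
    by (intro has_derivative_partial_deriv) (simp add: differentiable_on_eq_differentiable_at)
  show "partial_deriv 1 (partial_deriv 1 f) x + partial_deriv 2 (partial_deriv 2 f) x = - (\<kappa>\<^sup>2 *\<^sub>R f x)"
    if "x \<in> U" for x
    using eq[OF that] by (simp add: laplacian_def sum_2 scaleR_conv_of_real eq_neg_iff_add_eq_0)
qed (use U C2 in \<open>auto simp: C2_on_def\<close>)

lemma planar_helmholtz_diff:
  assumes "planar_helmholtz \<kappa> U f\<^sub>1 g\<^sub>1 H\<^sub>1" "planar_helmholtz \<kappa> U f\<^sub>2 g\<^sub>2 H\<^sub>2"
  shows "planar_helmholtz \<kappa> U (\<lambda>x. f\<^sub>1 x - f\<^sub>2 x) (\<lambda>i x. g\<^sub>1 i x - g\<^sub>2 i x) (\<lambda>i j x. H\<^sub>1 i j x - H\<^sub>2 i j x)"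
proof -
  interpret a: planar_helmholtz \<kappa> U f\<^sub>1 g\<^sub>1 H\<^sub>1 by fact
  interpret b: planar_helmholtz \<kappa> U f\<^sub>2 g\<^sub>2 H\<^sub>2 by fact
  show ?thesis
  proof
    fix x assume x: "x \<in> U"
    show "((\<lambda>x. f\<^sub>1 x - f\<^sub>2 x) has_derivative (\<lambda>h. h $ 1 *\<^sub>R (g\<^sub>1 1 x - g\<^sub>2 1 x) + h $ 2 *\<^sub>R (g\<^sub>1 2 x - g\<^sub>2 2 x))) (at x)"
      by (rule has_derivative_eq_rhs[OF has_derivative_diff[OF a.f_deriv[OF x] b.f_deriv[OF x]]])
        (simp add: fun_eq_iff algebra_simps)
    show "((\<lambda>x. g\<^sub>1 i x - g\<^sub>2 i x) has_derivative
        (\<lambda>h. h $ 1 *\<^sub>R (H\<^sub>1 i 1 x - H\<^sub>2 i 1 x) + h $ 2 *\<^sub>R (H\<^sub>1 i 2 x - H\<^sub>2 i 2 x))) (at x)" for i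
      by (rule has_derivative_eq_rhs[OF has_derivative_diff[OF a.g_deriv[OF x] b.g_deriv[OF x]]])
        (simp add: fun_eq_iff algebra_simps)
    show "H\<^sub>1 1 1 x - H\<^sub>2 1 1 x + (H\<^sub>1 2 2 x - H\<^sub>2 2 2 x) = - (\<kappa>\<^sup>2 *\<^sub>R (f\<^sub>1 x - f\<^sub>2 x))"
      using a.helmholtz_eq[OF x] b.helmholtz_eq[OF x] by (simp add: algebra_simps)
  qed (auto intro!: continuous_on_diff a.open_U a.H_cont b.H_cont)
qed

section \<open>Real-linear images, and the way back to \<open>partial_deriv\<close>\<close>

context planar_helmholtz
begin

text \<open>Meant for the imaginary part followed by the embedding of the reals. The equation
  survives because its coefficient is real.\<close>

lemma linear_image:
  assumes "bounded_linear L"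
  shows "planar_helmholtz \<kappa> U (\<lambda>x. L (f x)) (\<lambda>i x. L (g i x)) (\<lambda>i j x. L (H i j x))"
proof -
  interpret L: bounded_linear L by fact
  show ?thesis
  proof
    fix x assume x: "x \<in> U"
    show "((\<lambda>x. L (f x)) has_derivative (\<lambda>h. h $ 1 *\<^sub>R L (g 1 x) + h $ 2 *\<^sub>R L (g 2 x))) (at x)"
      using L.has_derivative[OF f_deriv[OF x]] by (simp add: L.add L.scaleR)
    show "((\<lambda>x. L (g i x)) has_derivative (\<lambda>h. h $ 1 *\<^sub>R L (H i 1 x) + h $ 2 *\<^sub>R L (H i 2 x))) (at x)" for i
      using L.has_derivative[OF g_deriv[OF x]] by (simp add: L.add L.scaleR)
    show "L (H 1 1 x) + L (H 2 2 x) = - (\<kappa>\<^sup>2 *\<^sub>R L (f x))"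
      using arg_cong[OF helmholtz_eq[OF x], of L] by (simp add: L.add L.scaleR L.neg)
  qed (auto intro!: open_U L.continuous_on H_cont)
qed

lemma partial_deriv_f: "x \<in> U \<Longrightarrow> partial_deriv i f x = g i x"
  using partial_deriv_eq[OF f_deriv] .

text \<open>The function \<open>partial_deriv i f\<close> is known to agree with \<open>g i\<close>
  only on \<open>U\<close>; as \<open>U\<close> is open, that is enough to transfer the
  derivative.\<close>

lemma partial_deriv_has_derivative:
  assumes x: "x \<in> U"
  shows "(partial_deriv i f has_derivative (\<lambda>h. h $ 1 *\<^sub>R H i 1 x + h $ 2 *\<^sub>R H i 2 x)) (at x)"
  by (rule has_derivative_transform_within_open[OF g_deriv[OF x, of i] open_U x]) (simp add: partial_deriv_f)

lemma partial_deriv2_f: "x \<in> U \<Longrightarrow> partial_deriv j (partial_deriv i f) x = H i j x"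
  using partial_deriv_eq[OF partial_deriv_has_derivative] .

lemma C2_on_f: "C2_on U f"
proof -
  have "continuous_on U (partial_deriv j (partial_deriv i f))" for i j
    using H_cont[of i j] by (rule continuous_on_eq) (simp add: partial_deriv2_f)
  moreover have "f differentiable_on U" "partial_deriv i f differentiable_on U" for i
    using f_deriv partial_deriv_has_derivative
    by (meson differentiable_at_imp_differentiable_on differentiable_def)+
  ultimately show ?thesis unfolding C2_on_def by blast
qed

lemma laplacian_f: "x \<in> U \<Longrightarrow> laplacian f x = - (of_real (\<kappa>\<^sup>2) * f x)"
  using helmholtz_eq by (simp add: laplacian_def sum_2 partial_deriv2_f scaleR_conv_of_real)

lemma g_eq_0:
  assumes "\<And>x. x \<in> U \<Longrightarrow> f x = 0" "x \<in> U"
  shows "g i x = 0"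
proof -
  have "(f has_derivative (\<lambda>h. h $ 1 *\<^sub>R 0 + h $ 2 *\<^sub>R 0)) (at x)"
    by (rule has_derivative_transform_within_open[OF _ open_U assms(2), of "\<lambda>_. 0"]) (simp_all add: assms(1))
  from partial_deriv_eq[where a = "\<lambda>_. 0", OF this] show ?thesis
    using partial_deriv_f[OF assms(2), of i] by simp
qed

text \<open>Otherwise f itself would be an eigenfunction. The eigenvalue notion speaks of
  \<open>C2_on D\<close>, so the locale is instantiated anew with \<open>D\<close> as
  domain.\<close>

lemma zero_if_no_dirichlet_eigenvalue:
  assumes D: "open D" "closure D \<subseteq> U" and "\<not> dirichlet_eigenvalue D (\<kappa>\<^sup>2)"
    and "\<And>x. x \<in> frontier D \<Longrightarrow> f x = 0" "x \<in> D"
  shows "f x = 0"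
proof -
  have DU: "D \<subseteq> U" using D closure_subset by blast
  interpret D: planar_helmholtz \<kappa> D f g H
    using D DU f_deriv g_deriv helmholtz_eq
    by unfold_locales (auto intro: continuous_on_subset[OF H_cont])
  have "continuous_on (closure D) f" using f_cont D(2) by (rule continuous_on_subset)
  then show ?thesis
    using assms D.C2_on_f D.laplacian_f unfolding dirichlet_eigenvalue_def by fastforce
qed

text \<open>The radiation condition in terms of angle and gradient. Radii beyond \<open>R\<close>
  put the circle into \<open>U\<close>, where the derivative along the ray is given by
  \<open>g\<close>.\<close>

lemma sommerfeld_polar:
  assumes "sommerfeld \<kappa> f" and R: "\<And>x. norm x > R \<Longrightarrow> x \<in> U" and "e > 0"
  shows "\<forall>\<^sub>F r in at_top. \<forall>\<theta>. norm (sqrt r *\<^sub>R (cos \<theta> *\<^sub>R g 1 (polar 0 r \<theta>) + sin \<theta> *\<^sub>R g 2 (polar 0 r \<theta>)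
      - \<i> * of_real \<kappa> * f (polar 0 r \<theta>))) < e"
  using uniform_limitD[OF assms(1)[unfolded sommerfeld_def] \<open>e > 0\<close>] eventually_gt_at_top[of R] eventually_gt_at_top[of 0]
proof eventually_elim
  case (elim r)
  show ?case
  proof
    fix \<theta>
    have p: "s *\<^sub>R polar 0 1 \<theta> = polar 0 s \<theta>" for s
      by (simp add: vec_eq_iff forall_2)
    have "polar 0 r \<theta> \<in> U" using elim dist_polar[of 0 r \<theta>] by (intro R) simp
    from has_vector_derivative_chain_at[OF has_vector_derivative_polar_radius f_deriv[OF this]]
    have vd: "vector_derivative (\<lambda>s. f (polar 0 s \<theta>)) (at r)
        = cos \<theta> *\<^sub>R g 1 (polar 0 r \<theta>) + sin \<theta> *\<^sub>R g 2 (polar 0 r \<theta>)"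
      by (simp add: vector_derivative_at)
    have "polar 0 1 \<theta> \<in> sphere 0 1" using dist_polar[of 0 1 \<theta>] by simp
    from bspec[OF elim(1) this]
    show "norm (sqrt r *\<^sub>R (cos \<theta> *\<^sub>R g 1 (polar 0 r \<theta>) + sin \<theta> *\<^sub>R g 2 (polar 0 r \<theta>)
      - \<i> * of_real \<kappa> * f (polar 0 r \<theta>))) < e"
      unfolding p vd dist_0_norm dist_norm diff_zero norm_mult norm_scaleR norm_of_real .
  qed
qed

end

theorem theorem3:
  fixes \<kappa> :: real
    and U D \<Lambda> :: "(real^2) set"
    and \<psi>\<^sub>1 \<psi>\<^sub>2 :: "real^2 \<Rightarrow> complex"
  assumes "\<kappa> > 0"
    and "exterior_region U"
    and "open D" and "connected D" and "D \<noteq> {}" and "bounded D"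
    and "real_analytic_curve (frontier D)" and "connected (frontier D)"
    and "closure D \<subseteq> U"
    and "\<not> dirichlet_eigenvalue D (\<kappa>\<^sup>2)"
    and "open_arc_of (frontier D) \<Lambda>"
    and "radiation_solution \<kappa> U \<psi>\<^sub>1"
    and "radiation_solution \<kappa> U \<psi>\<^sub>2"
    and "\<forall>x\<in>\<Lambda>. Im (\<psi>\<^sub>1 x) = Im (\<psi>\<^sub>2 x)"
  shows "\<forall>x\<in>U. \<psi>\<^sub>1 x = \<psi>\<^sub>2 x"
proof -
  note \<kappa> = \<open>\<kappa> > 0\<close>
  obtain S where U: "open U" "connected U" and S: "closed_regular_curve S" "U = outside S"
    using assms(2) unfolding exterior_region_def by blast
  have "bounded S"
    using S(1) unfolding closed_regular_curve_def by (metis bounded_simple_path_image)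
  then have "bounded (- U)" unfolding S(2) by (rule cobounded_outside)
  then obtain R where R: "R > 0" "\<And>x. norm x > R \<Longrightarrow> x \<in> U"
    unfolding bounded_pos by (metis ComplI not_le)
  obtain g\<^sub>1 H\<^sub>1 where \<psi>\<^sub>1: "planar_helmholtz \<kappa> U \<psi>\<^sub>1 g\<^sub>1 H\<^sub>1"
    using assms(12) U(1) planar_helmholtz_of_C2 unfolding radiation_solution_def by blast
  obtain g\<^sub>2 H\<^sub>2 where \<psi>\<^sub>2: "planar_helmholtz \<kappa> U \<psi>\<^sub>2 g\<^sub>2 H\<^sub>2"
    using assms(13) U(1) planar_helmholtz_of_C2 unfolding radiation_solution_def by blast
  define f where "f = (\<lambda>x. \<psi>\<^sub>1 x - \<psi>\<^sub>2 x)"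
  define g where "g = (\<lambda>i x. g\<^sub>1 i x - g\<^sub>2 i x)"
  define H where "H = (\<lambda>i j x. H\<^sub>1 i j x - H\<^sub>2 i j x)"
  interpret \<psi>\<^sub>1: planar_helmholtz \<kappa> U \<psi>\<^sub>1 g\<^sub>1 H\<^sub>1 by fact
  interpret \<psi>\<^sub>2: planar_helmholtz \<kappa> U \<psi>\<^sub>2 g\<^sub>2 H\<^sub>2 by fact
  interpret f: planar_helmholtz \<kappa> U f g H
    unfolding f_def g_def H_def by (rule planar_helmholtz_diff[OF \<psi>\<^sub>1 \<psi>\<^sub>2])
  interpret im: planar_helmholtz \<kappa> U "\<lambda>x. of_real (Im (f x))" "\<lambda>i x. of_real (Im (g i x))" "\<lambda>i j x. of_real (Im (H i j x))"
    by (rule f.linear_image) (intro bounded_linear_compose[OF bounded_linear_of_real bounded_linear_Im])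

  \<comment> \<open>An arc is nonempty, being a homeomorphic copy of an open interval.\<close>
  obtain h k where "homeomorphism \<Lambda> {0<..<1::real} h k"
    using assms(11) unfolding open_arc_of_def homeomorphic_def by blast
  then have "k ` {0<..<1} = \<Lambda>" by (rule homeomorphism_image2)
  then have "\<Lambda> \<noteq> {}" by auto
  have \<Lambda>: "openin (top_of_set (frontier D)) \<Lambda>"
    using assms(11) unfolding open_arc_of_def by blast
  have im_\<Lambda>: "complex_of_real (Im (f x)) = 0" if "x \<in> \<Lambda>" for x
    using assms(14) that by (simp add: f_def)
  have "frontier D \<subseteq> U" using assms(9) by (auto simp: frontier_def)
  then have "complex_of_real (Im (f x)) = 0" if "x \<in> frontier D" for x
    by (rule im.zero_on_analytic_curve[OF \<kappa> assms(7,8) _ \<Lambda> \<open>\<Lambda> \<noteq> {}\<close> im_\<Lambda> that])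
  then have im_D: "complex_of_real (Im (f x)) = 0" if "x \<in> D" for x
    using that by (rule im.zero_if_no_dirichlet_eigenvalue[OF assms(3,9,10)])
  have "D \<subseteq> U" using assms(9) closure_subset by blast
  have im_U: "complex_of_real (Im (f x)) = 0" if "x \<in> U" for x
    by (rule im.unique_continuation[OF \<kappa> U(2) assms(3,5) \<open>D \<subseteq> U\<close> im_D that])
  have im_g: "Im (g i x) = 0" if "x \<in> U" for i x
    using im.g_eq_0[OF im_U that, of i] by simp
  have im_f: "Im (f x) = 0" if "x \<in> U" for x
    using im_U[OF that] by simp

  have rad: "\<forall>\<^sub>F r in at_top. \<forall>\<theta>.
      norm (sqrt r *\<^sub>R (cos \<theta> *\<^sub>R g 1 (polar 0 r \<theta>) + sin \<theta> *\<^sub>R g 2 (polar 0 r \<theta>))) < e \<and>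
      norm (sqrt r *\<^sub>R f (polar 0 r \<theta>)) < e / \<kappa>" if "e > 0" for e
  proof -
    have "sommerfeld \<kappa> \<psi>\<^sub>1" "sommerfeld \<kappa> \<psi>\<^sub>2"
      using assms(12,13) unfolding radiation_solution_def by auto
    moreover have "e / 2 > 0" using that by simp
    ultimately have "\<forall>\<^sub>F r in at_top. \<forall>\<theta>. norm (sqrt r *\<^sub>R (cos \<theta> *\<^sub>R g\<^sub>1 1 (polar 0 r \<theta>) + sin \<theta> *\<^sub>R g\<^sub>1 2 (polar 0 r \<theta>)
        - \<i> * of_real \<kappa> * \<psi>\<^sub>1 (polar 0 r \<theta>))) < e / 2"
      "\<forall>\<^sub>F r in at_top. \<forall>\<theta>. norm (sqrt r *\<^sub>R (cos \<theta> *\<^sub>R g\<^sub>2 1 (polar 0 r \<theta>) + sin \<theta> *\<^sub>R g\<^sub>2 2 (polar 0 r \<theta>)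
        - \<i> * of_real \<kappa> * \<psi>\<^sub>2 (polar 0 r \<theta>))) < e / 2"
      using \<psi>\<^sub>1.sommerfeld_polar \<psi>\<^sub>2.sommerfeld_polar R(2) by blast+
    with eventually_gt_at_top[of R] show ?thesis
    proof eventually_elim
      case (elim r)
      show ?case
      proof
        fix \<theta>
        let ?x = "polar 0 r \<theta>"
        have x: "?x \<in> U" using elim(1) dist_polar[of 0 r \<theta>] by (intro R(2)) simp
        define G where "G = sqrt r *\<^sub>R (cos \<theta> *\<^sub>R g 1 ?x + sin \<theta> *\<^sub>R g 2 ?x)"
        define F where "F = sqrt r *\<^sub>R f ?x"
        have im0: "Im G = 0" "Im F = 0"
          using im_g[OF x] im_f[OF x] by (simp_all add: G_def F_def)
        \<comment> \<open>The radiation condition is linear, so the difference satisfies it with the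
          two errors e / 2 added. As \<open>G\<close> and \<open>F\<close> are real, its real part
          bounds \<open>G\<close> and its imaginary part bounds \<open>\<kappa>\<close> times
          \<open>F\<close>.\<close>
        have "G - \<i> * of_real \<kappa> * F
          = sqrt r *\<^sub>R (cos \<theta> *\<^sub>R g\<^sub>1 1 ?x + sin \<theta> *\<^sub>R g\<^sub>1 2 ?x - \<i> * of_real \<kappa> * \<psi>\<^sub>1 ?x)
          - sqrt r *\<^sub>R (cos \<theta> *\<^sub>R g\<^sub>2 1 ?x + sin \<theta> *\<^sub>R g\<^sub>2 2 ?x - \<i> * of_real \<kappa> * \<psi>\<^sub>2 ?x)"
          by (simp add: G_def F_def g_def f_def algebra_simps)
        also have "norm \<dots> < e / 2 + e / 2"
          using norm_triangle_ineq4 elim(2,3) by (smt (verit, best))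
        finally have less: "norm (G - \<i> * of_real \<kappa> * F) < e" by simp
        have "Re (G - \<i> * of_real \<kappa> * F) = Re G" "Im (G - \<i> * of_real \<kappa> * F) = - (\<kappa> * Re F)"
          using im0 by simp_all
        then have "\<bar>Re G\<bar> < e" "\<bar>\<kappa> * Re F\<bar> < e"
          using abs_Re_le_cmod[of "G - \<i> * of_real \<kappa> * F"] abs_Im_le_cmod[of "G - \<i> * of_real \<kappa> * F"] less im0
          by simp_all
        moreover have "norm G = \<bar>Re G\<bar>" "norm F = \<bar>Re F\<bar>"
          using im0 by (simp_all add: cmod_eq_Re)
        ultimately show "norm G < e \<and> norm F < e / \<kappa>"
          using \<kappa> by (simp add: abs_mult field_simps)
      qed
    qed
  qed
  have far: "f x = 0" if "norm x > R" for x
  proof (rule f.rellich[OF \<kappa> _ R(2) _ _ that])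
    \<comment> \<open>\<open>rad\<close> bounds the function by e / kappa, so it is used with kappa
      * e.\<close>
    show "\<forall>\<^sub>F r in at_top. \<forall>\<theta>. norm (sqrt r *\<^sub>R f (polar 0 r \<theta>)) < e" if "e > 0" for e
      using rad[of "\<kappa> * e"] that \<kappa> by (auto elim!: eventually_mono)
    show "\<forall>\<^sub>F r in at_top. \<forall>\<theta>. norm (sqrt r *\<^sub>R (cos \<theta> *\<^sub>R g 1 (polar 0 r \<theta>) + sin \<theta> *\<^sub>R g 2 (polar 0 r \<theta>))) < e"
      if "e > 0" for e
      using rad[OF that] by (auto elim!: eventually_mono)
  qed (use R in auto)
  have "open {x :: real^2. norm x > R}"
    by (intro open_Collect_less continuous_intros)
  moreover have "{x :: real^2. norm x > R} \<noteq> {}"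
    using dist_polar[of 0 "R + 1" 0] R(1) by (auto intro!: exI[of _ "polar 0 (R + 1) 0"])
  moreover have "{x :: real^2. norm x > R} \<subseteq> U"
    using R(2) by blast
  ultimately have "f x = 0" if "x \<in> U" for x
    by (rule f.unique_continuation[OF \<kappa> U(2) _ _ _ _ that]) (simp add: far)
  then show ?thesis by (simp add: f_def)
qed

end
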